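(* Let $V$ be an $n$-dimensional vector space over $\mathbb{F}_q$, let $2\leq s<n$, and let $\mathcal{F}\subseteq\mathcal{L}(V)$ be an $s$-union antichain. Then: (i) $|\mathcal{F}|\leq\left[n\atop \lfloor s/2\rfloor\right]$. Moreover, equality holds if and only if either (a) $\mathcal{F}=\left[V\atop \lfloor s/2\rfloor\right]$; or (b) $s=2d+1$ and $\mathcal{F}=\mathcal{F}_d\cup\mathcal{F}_{d+1}$, where $\mathcal{F}_{d+1}\subseteq\left[V\atop d+1\right]$, $\mathcal{F}_d=\left[V\atop d\right]\setminus\bigtriangleup(\mathcal{F}_{d+1})$ and $|\bigtriangleup(\mathcal{F}_{d+1})|=|\mathcal{F}_{d+1}|$. (ii) Suppose $s=2d$ and $\mathcal{F}\nsubseteq\left[V\atop d\right]$. (a) If $d=1$, then $|\mathcal{F}|\leq\left[n\atop 1\right]-q$, with equality if and only if $\mathcal{F}=\mathcal{B}[n,2]$. (b) If $d\geq 2$, then $|\mathcal{F}|\leq\left[n\atop d\right]-q\left[n-d\atop 1\right]$, with equality if and only if $\mathcal{F}=\mathcal{A}[n,2d]$.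
   Context: $\left[m\atop k\right]=\prod_{0\leq i<k}\frac{q^{m-i}-1}{q^{k-i}-1}$ is the Gaussian binomial coefficient; $\left[V\atop k\right]$ is the set of $k$-dimensional subspaces of $V$ and $\mathcal{L}(V)$ the set of all subspaces. $\mathcal{F}$ is $s$-union if $\dim(F+F')\leq s$ for all $F,F'\in\mathcal{F}$, and an antichain if $F\nleq F'$ for distinct $F,F'\in\mathcal{F}$. For $\mathcal{H}\subseteq\left[V\atop u\right]$, the shadow is $\bigtriangleup(\mathcal{H})=\{G\in\left[V\atop u-1\right]:G\leq H\text{ for some }H\in\mathcal{H}\}$. $\mathcal{A}[n,s]=(\left[V\atop \lceil s/2\rceil\right]\setminus\{F\in\left[V\atop \lceil s/2\rceil\right]:U\leq F\})\cup\{U\}$ with $U$ a fixed $(\lceil s/2\rceil-1)$-dimensional subspace; $\mathcal{B}[n,s]=(\left[V\atop \lfloor s/2\rfloor\right]\setminus\{F\in\left[V\atop \lfloor s/2\rfloor\right]:F\leq W\})\cup\{W\}$ with $W$ a fixed $(\lfloor s/2\rfloor+1)$-dimensional subspace. *)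

theory Defs
  imports Complex_Main "HOL-Library.Cardinality"
begin

text \<open>For \<open>k > m\<close> the truncated subtraction is harmless: the factor \<open>i = m\<close> vanishes, so the
  product is \<open>0\<close>.\<close>

definition gauss_binomial :: "nat \<Rightarrow> nat \<Rightarrow> nat \<Rightarrow> real" where
  "gauss_binomial q m k = (\<Prod>i<k. (real q ^ (m - i) - 1) / (real q ^ (k - i) - 1))"

text \<open>The vector space \<open>V\<close> is the whole type \<open>'b\<close> with scalar multiplication \<open>scale\<close>. The
  definitions are not made inside the locale \<^locale>\<open>vector_space\<close> because its interpretation for
  real vector spaces would capture the new names.\<close>

definition all_subspaces :: "('a::field \<Rightarrow> 'b::ab_group_add \<Rightarrow> 'b) \<Rightarrow> 'b set set" where
  "all_subspaces scale = {F. module.subspace scale F}"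

definition subspaces_of_dim :: "('a::field \<Rightarrow> 'b::ab_group_add \<Rightarrow> 'b) \<Rightarrow> nat \<Rightarrow> 'b set set" where
  "subspaces_of_dim scale k = {F. module.subspace scale F \<and> vector_space.dim scale F = k}"

definition s_union :: "('a::field \<Rightarrow> 'b::ab_group_add \<Rightarrow> 'b) \<Rightarrow> nat \<Rightarrow> 'b set set \<Rightarrow> bool" where
  "s_union scale s \<F> \<longleftrightarrow>
    (\<forall>F\<in>\<F>. \<forall>F'\<in>\<F>. vector_space.dim scale {x + y | x y. x \<in> F \<and> y \<in> F'} \<le> s)"

definition subspace_antichain :: "'b set set \<Rightarrow> bool" where
  "subspace_antichain \<F> \<longleftrightarrow> (\<forall>F\<in>\<F>. \<forall>F'\<in>\<F>. F \<noteq> F' \<longrightarrow> \<not> F \<subseteq> F')"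

text \<open>The shadow of a family \<open>\<H>\<close> of \<open>u\<close>-dimensional subspaces; stating the dimension of \<open>G\<close> as
  an equation avoids truncated subtraction at \<open>u = 0\<close>.\<close>

definition shadow ::
  "('a::field \<Rightarrow> 'b::ab_group_add \<Rightarrow> 'b) \<Rightarrow> nat \<Rightarrow> 'b set set \<Rightarrow> 'b set set" where
  "shadow scale u \<H> =
    {G. module.subspace scale G \<and> vector_space.dim scale G + 1 = u \<and> (\<exists>H\<in>\<H>. G \<subseteq> H)}"

text \<open>The families \<open>\<A>[n,s]\<close> and \<open>\<B>[n,s]\<close>, with the fixed subspace as an explicit argument.
  Here \<open>\<lfloor>s/2\<rfloor>\<close> is \<^term>\<open>s div 2\<close> and \<open>\<lceil>s/2\<rceil>\<close> is \<^term>\<open>(s + 1) div 2\<close>. The predicates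
  \<open>is_family_A\<close> and \<open>is_family_B\<close> say that \<open>\<F>\<close> is such a family for some choice of the fixed
  subspace, of dimension \<open>\<lceil>s/2\<rceil> - 1\<close> and \<open>\<lfloor>s/2\<rfloor> + 1\<close> respectively.\<close>

definition family_A ::
  "('a::field \<Rightarrow> 'b::ab_group_add \<Rightarrow> 'b) \<Rightarrow> nat \<Rightarrow> 'b set \<Rightarrow> 'b set set" where
  "family_A scale s U =
    (subspaces_of_dim scale ((s + 1) div 2) -
      {F \<in> subspaces_of_dim scale ((s + 1) div 2). U \<subseteq> F}) \<union> {U}"

definition family_B ::
  "('a::field \<Rightarrow> 'b::ab_group_add \<Rightarrow> 'b) \<Rightarrow> nat \<Rightarrow> 'b set \<Rightarrow> 'b set set" where
  "family_B scale s W =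
    (subspaces_of_dim scale (s div 2) -
      {F \<in> subspaces_of_dim scale (s div 2). F \<subseteq> W}) \<union> {W}"

definition is_family_A ::
  "('a::field \<Rightarrow> 'b::ab_group_add \<Rightarrow> 'b) \<Rightarrow> nat \<Rightarrow> 'b set set \<Rightarrow> bool" where
  "is_family_A scale s \<F> \<longleftrightarrow>
    (\<exists>U\<in>subspaces_of_dim scale ((s + 1) div 2 - 1). \<F> = family_A scale s U)"

definition is_family_B ::
  "('a::field \<Rightarrow> 'b::ab_group_add \<Rightarrow> 'b) \<Rightarrow> nat \<Rightarrow> 'b set set \<Rightarrow> bool" where
  "is_family_B scale s \<F> \<longleftrightarrow>
    (\<exists>W\<in>subspaces_of_dim scale (s div 2 + 1). \<F> = family_B scale s W)"

end

theory Submission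
  imports Defs
begin

text \<open>Let \<open>d = \<lfloor>s/2\<rfloor>\<close>. Members of dimension \<open>u > d\<close> meet pairwise nontrivially, and such a family
  is at most as large as its shadow: the incidence matrix of the family against the
  \<open>(u-1)\<close>-subspaces has full row rank. Hence the top level can be replaced repeatedly by its shadow,
  until all dimensions are at most \<open>d\<close>; since \<open>n > 2d\<close>, levels below \<open>d\<close> can then be replaced by
  their upper shadows with strict gain. This bounds \<open>|\<F>|\<close> by the number of \<open>d\<close>-subspaces.

  Every subspace occurring after the downward replacement still lies below a member of \<open>\<F>\<close>. So if
  \<open>\<F>\<close> contains \<open>W\<close> with \<open>dim W + d > s\<close>, none of the \<open>q^(d(n-d))\<close> complements of an
  \<open>(n-d)\<close>-dimensional space containing a suitable part of \<open>W\<close> is reached. This large defect settles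
  uniqueness in (i) and eliminates members of dimension above \<open>d\<close> in (ii). What remains in (ii) is
  that the upper shadow of a nonempty family of \<open>(d-1)\<close>-subspaces exceeds it by at least
  \<open>q[n-d,1]\<close>, with equality only for a single subspace. For \<open>d = 1\<close>, part (ii) is degenerate:
  \<open>\<F>\<close> has one element and \<open>\<B>[n,2]\<close> is not 2-union.\<close>

subsection \<open>Linear systems and power sums\<close>

text \<open>Gaussian elimination: one equation is solved for an unknown with nonzero coefficient and
  substituted into the others, which leaves one equation and one unknown fewer. It later supplies a
  kernel vector of an incidence matrix.\<close>

lemma underdetermined_system:
  fixes M :: "'i \<Rightarrow> 'j \<Rightarrow> real"
  assumes "finite B" "finite A" "card B < card A"
  shows "\<exists>x. (\<exists>a\<in>A. x a \<noteq> 0) \<and> (\<forall>b\<in>B. (\<Sum>a\<in>A. M b a * x a) = 0)"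
  using assms
proof (induction B arbitrary: A M)
  case empty
  then show ?case by (intro exI[of _ "\<lambda>_. 1"]) (auto simp: card_gt_0_iff)
next
  case (insert b B)
  show ?case
  proof (cases "\<forall>a\<in>A. M b a = 0")
    case True
    then show ?thesis
      using insert.IH[of A M] insert.prems insert.hyps by auto
  next
    case False
    then obtain a0 where a0: "a0 \<in> A" "M b a0 \<noteq> 0" by blast
    let ?A = "A - {a0}"
    have "card B < card ?A"
      using insert a0 by simp
    then obtain x where x: "\<exists>a\<in>?A. x a \<noteq> 0"
        "\<forall>b'\<in>B. (\<Sum>a\<in>?A. (M b' a - M b' a0 * M b a / M b a0) * x a) = 0"
      using insert.IH[of ?A "\<lambda>b' a. M b' a - M b' a0 * M b a / M b a0"] insert.prems by auto
    \<comment> \<open>\<open>y\<close> agrees with \<open>x\<close> away from \<open>a0\<close> and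
      takes at \<open>a0\<close> the value that solves equation \<open>b\<close>; every other
      equation for \<open>y\<close> then turns into its reduced form for \<open>x\<close>.\<close>
    define y where "y = x(a0 := - (\<Sum>a\<in>?A. M b a * x a) / M b a0)"
    have split: "(\<Sum>a\<in>A. M b' a * y a) =
        (\<Sum>a\<in>?A. M b' a * x a) - M b' a0 * ((\<Sum>a\<in>?A. M b a * x a) / M b a0)" for b'
    proof -
      have "(\<Sum>a\<in>A. M b' a * y a) = M b' a0 * y a0 + (\<Sum>a\<in>?A. M b' a * y a)"
        using a0 insert.prems by (simp add: sum.remove)
      also have "(\<Sum>a\<in>?A. M b' a * y a) = (\<Sum>a\<in>?A. M b' a * x a)"
        by (rule sum.cong) (auto simp: y_def)
      finally show ?thesis by (simp add: y_def)
    qed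
    have "(\<Sum>a\<in>A. M b' a * y a) = 0" if "b' \<in> B" for b'
    proof -
      have "(\<Sum>a\<in>A. M b' a * y a) =
          (\<Sum>a\<in>?A. (M b' a - M b' a0 * M b a / M b a0) * x a)"
        unfolding split by (simp add: sum_subtractf sum_distrib_left sum_divide_distrib algebra_simps)
      then show ?thesis using x that by simp
    qed
    moreover have "(\<Sum>a\<in>A. M b a * y a) = 0"
      unfolding split using a0 by simp
    moreover have "\<exists>a\<in>A. y a \<noteq> 0"
      using x(1) by (auto simp: y_def)
    ultimately show ?thesis by blast
  qed
qed

text \<open>By linearity, weights that annihilate all powers up to \<open>m\<close> annihilate every
  polynomial of degree at most \<open>m\<close>, here one given by its roots. The extra power
  \<open>r\<close> is what the induction needs: splitting off a linear factor either raises
  \<open>r\<close> by one or leaves it.\<close>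

lemma sum_power_mult_prod_eq_0:
  fixes x y :: "'i \<Rightarrow> real" and c :: "'j \<Rightarrow> real"
  assumes "\<And>r. r \<le> m \<Longrightarrow> (\<Sum>i\<in>A. x i * y i ^ r) = 0"
    and "finite J" "r + card J \<le> m"
  shows "(\<Sum>i\<in>A. x i * y i ^ r * (\<Prod>j\<in>J. y i - c j)) = 0"
  using assms(2,3)
proof (induction J arbitrary: r)
  case empty
  then show ?case using assms(1) by simp
next
  case (insert j J)
  have "(\<Sum>i\<in>A. x i * y i ^ r * (\<Prod>j\<in>insert j J. y i - c j)) =
      (\<Sum>i\<in>A. x i * y i ^ Suc r * (\<Prod>j\<in>J. y i - c j)) - c j * (\<Sum>i\<in>A. x i * y i ^ r * (\<Prod>j\<in>J. y i - c j))"
    using insert.hyps by (simp add: sum_distrib_left algebra_simps flip: sum_subtractf)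
  then show ?case
    using insert.IH[of r] insert.IH[of "Suc r"] insert.prems insert.hyps by simp
qed

subsection \<open>Counting subspaces\<close>

text \<open>\<open>q\<close> is a parameter tied to the field by an equation, so that an
  interpretation can use a \<open>q\<close> that is already fixed.\<close>

locale finite_field_space = finite_dimensional_vector_space scale Basis
  for scale :: "'a::{field,finite} \<Rightarrow> 'b::ab_group_add \<Rightarrow> 'b" (infixr "*s" 75) and Basis +
  fixes q :: nat
  assumes q_eq: "q = CARD('a)"
begin

abbreviation n :: nat where "n \<equiv> card Basis"

lemma q_ge_2: "2 \<le> q"
proof -
  have "card {0, 1 :: 'a} \<le> q"
    unfolding q_eq by (intro card_mono) auto
  then show ?thesis by simp
qed

text \<open>Each vector of the larger span is \<open>k *s b + x\<close> for exactly one scalar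
  \<open>k\<close> and one \<open>x\<close> in the smaller span, so adjoining \<open>b\<close>
  multiplies the size by \<open>q\<close>.\<close>

lemma finite_card_span:
  assumes "finite B" "independent B"
  shows "finite (span B) \<and> card (span B) = q ^ card B"
  using assms
proof (induction B)
  case empty
  then show ?case by simp
next
  case (insert b B)
  have ind: "independent B" and b: "b \<notin> span B"
    using insert by (auto simp: independent_insert)
  have IH: "finite (span B)" "card (span B) = q ^ card B"
    using insert.IH[OF ind] by auto
  let ?f = "\<lambda>(k, x). k *s b + x"
  have img: "span (insert b B) = ?f ` (UNIV \<times> span B)"
  proof (intro set_eqI iffI)
    fix x assume "x \<in> span (insert b B)"
    then obtain k where "x - k *s b \<in> span B"
      by (auto simp: span_insert)
    then show "x \<in> ?f ` (UNIV \<times> span B)"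
      by (intro image_eqI[of _ _ "(k, x - k *s b)"]) auto
  next
    fix x assume "x \<in> ?f ` (UNIV \<times> span B)"
    then show "x \<in> span (insert b B)"
      by (auto intro!: span_add span_scale intro: span_base span_mono[THEN subsetD])
  qed
  have inj: "inj_on ?f (UNIV \<times> span B)"
  proof (rule inj_onI, clarify)
    fix k x l y assume xy: "x \<in> span B" "y \<in> span B" and eq: "k *s b + x = l *s b + y"
    have "(k - l) *s b = y - x"
      using eq by (simp add: scale_left_diff_distrib algebra_simps)
    then have "(k - l) *s b \<in> span B"
      using xy span_diff by simp
    then have "k = l"
      using b by (metis eq_iff_diff_eq_0 span_scale scale_scale left_inverse scale_one)
    then show "k = l \<and> x = y" using eq by simp
  qed
  show ?case
    unfolding img using IH insert.hyps
    by (simp add: card_image[OF inj] card_cartesian_product q_eq)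
qed

lemma finite_vectors: "finite (A :: 'b set)"
  using finite_card_span[OF finite_Basis independent_Basis] span_Basis
  by (metis finite_subset subset_UNIV)

lemma finite_vector_sets: "finite (\<F> :: 'b set set)"
  by (metis finite_Pow_iff finite_vectors finite_subset Pow_UNIV subset_UNIV)

lemma card_subspace: "subspace S \<Longrightarrow> card S = q ^ dim S"
  using finite_card_span by (metis basis_subspace_exists)

lemma dim_le_n: "dim S \<le> n"
  using dim_subset_UNIV by (simp add: dimension_def)

text \<open>The dimension condition says that the entries are linearly independent modulo the span
  of \<open>W\<close>. Lists are used because ordered tuples can be counted entry by entry.\<close>

definition independent_tuples :: "'b set \<Rightarrow> 'b set \<Rightarrow> nat \<Rightarrow> 'b list set" where
  "independent_tuples W S k = {xs. length xs = k \<and> set xs \<subseteq> S \<and> dim (W \<union> set xs) = dim W + k}"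

lemma dim_Un_set_le: "dim (W \<union> set xs) \<le> dim W + length xs"
  by (induction xs) (auto simp: dim_insert)

lemma finite_independent_tuples: "finite (independent_tuples W S k)"
  by (rule finite_subset[OF _ finite_lists_length_eq[of S k]])
    (auto simp: independent_tuples_def finite_vectors)

text \<open>A tuple of length \<open>k\<close> can be prolonged by exactly the vectors of
  \<open>S\<close> outside the span of \<open>W\<close> and its entries, a space with
  \<open>q ^ (dim W + k)\<close> elements.\<close>

lemma card_independent_tuples:
  assumes "subspace S" "W \<subseteq> S"
  shows "real (card (independent_tuples W S k)) = (\<Prod>i<k. real q ^ dim S - real q ^ (dim W + i))"
proof (induction k)
  case 0
  have "independent_tuples W S 0 = {[]}"
    by (auto simp: independent_tuples_def)
  then show ?case by simp
next
  case (Suc k)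
  let ?T = "independent_tuples W S k"
  let ?P = "SIGMA xs:?T. S - span (W \<union> set xs)"
  have "bij_betw (\<lambda>(xs, x). x # xs) ?P (independent_tuples W S (Suc k))"
  proof (rule bij_betwI')
    fix p p' assume "p \<in> ?P" "p' \<in> ?P"
    then show "((\<lambda>(xs, x). x # xs) p = (\<lambda>(xs, x). x # xs) p') = (p = p')" by auto
  next
    fix p assume p: "p \<in> ?P"
    obtain xs x where [simp]: "p = (xs, x)" by force
    have "W \<union> set (x # xs) = insert x (W \<union> set xs)" by auto
    then have "dim (W \<union> set (x # xs)) = dim W + Suc k"
      using p by (simp add: independent_tuples_def dim_insert)
    then show "(\<lambda>(xs, x). x # xs) p \<in> independent_tuples W S (Suc k)"
      using p by (simp add: independent_tuples_def)
  next
    fix ys assume ys: "ys \<in> independent_tuples W S (Suc k)"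
    then obtain x xs where [simp]: "ys = x # xs"
      by (cases ys) (auto simp: independent_tuples_def)
    \<comment> \<open>Each vector raises the dimension by at most one, so a total gain of
      \<open>Suc k\<close> forces a gain of one from \<open>x\<close> and of \<open>k\<close> from
      \<open>xs\<close>.\<close>
    have "x \<notin> span (W \<union> set xs) \<and> dim (W \<union> set xs) = dim W + k"
      using ys dim_Un_set_le[of W xs]
      by (auto simp: independent_tuples_def dim_insert split: if_splits)
    then have "(xs, x) \<in> ?P"
      using ys by (auto simp: independent_tuples_def)
    then show "\<exists>p\<in>?P. ys = (\<lambda>(xs, x). x # xs) p" by force
  qed
  then have "card (independent_tuples W S (Suc k)) = card ?P"
    by (simp add: bij_betw_same_card)
  also have "\<dots> = (\<Sum>xs\<in>?T. card (S - span (W \<union> set xs)))"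
    by (rule card_SigmaI) (auto simp: finite_independent_tuples finite_vectors)
  also have "real \<dots> = (\<Sum>xs\<in>?T. real q ^ dim S - real q ^ (dim W + k))"
  proof (simp only: of_nat_sum, rule sum.cong[OF refl])
    fix xs assume xs: "xs \<in> ?T"
    then have sub: "span (W \<union> set xs) \<subseteq> S"
      using assms by (intro span_minimal) (auto simp: independent_tuples_def)
    have "card (span (W \<union> set xs)) = q ^ (dim W + k)"
      using xs by (simp add: card_subspace independent_tuples_def)
    moreover have "real (card (S - span (W \<union> set xs))) = real (card S) - real (card (span (W \<union> set xs)))"
      using sub by (simp add: card_Diff_subset finite_vectors card_mono of_nat_diff)
    ultimately show "real (card (S - span (W \<union> set xs))) = real q ^ dim S - real q ^ (dim W + k)"
      using assms by (simp add: card_subspace)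
  qed
  finally show ?case using Suc by simp
qed

section \<open>Subspaces that meet a given space trivially\<close>

lemma dim_Un_Int:
  assumes "subspace A" "subspace B"
  shows "dim (A \<union> B) + dim (A \<inter> B) = dim A + dim B"
proof -
  have "span (A \<union> B) = {x + y |x y. x \<in> A \<and> y \<in> B}"
    using assms by (simp add: span_Un span_eq_iff[THEN iffD2])
  then show ?thesis
    using dim_sums_Int[OF assms] by (metis dim_span)
qed

text \<open>\<open>W\<close> enters only through its span: \<open>W = {}\<close> gives all
  \<open>k\<close>-dimensional subspaces of \<open>S\<close>, and a \<open>W\<close> of codimension
  \<open>k\<close> in \<open>S\<close> gives the complements of its span.\<close>

definition disjoint_subspaces :: "'b set \<Rightarrow> 'b set \<Rightarrow> nat \<Rightarrow> 'b set set" where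
  "disjoint_subspaces W S k = {K. subspace K \<and> dim K = k \<and> K \<subseteq> S \<and> K \<inter> span W = {0}}"

text \<open>Tuples independent modulo \<open>W\<close> are sorted by their span \<open>K\<close>:
  the spans are the spaces to be counted, and each one arises from all of its ordered bases. The
  quotient of the two tuple counts is the number wanted.\<close>

lemma card_disjoint_subspaces:
  assumes S: "subspace S" and W: "W \<subseteq> S"
  shows "real (card (disjoint_subspaces W S k)) =
    (\<Prod>i<k. (real q ^ dim S - real q ^ (dim W + i)) / (real q ^ k - real q ^ i))"
proof -
  let ?D = "disjoint_subspaces W S k"
  have un: "independent_tuples W S k = (\<Union>K\<in>?D. independent_tuples {} K k)"
  proof (intro set_eqI iffI)
    fix xs assume xs: "xs \<in> independent_tuples W S k"
    let ?K = "span (set xs)"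
    have "span (W \<union> set xs) = span (span W \<union> ?K)"
      by (simp add: span_Un span_span)
    then have "dim (span W \<union> ?K) = dim W + k"
      using xs unfolding independent_tuples_def by (metis (mono_tags, lifting) dim_span mem_Collect_eq)
    then have "dim W + k + dim (span W \<inter> ?K) = dim W + dim ?K"
      using dim_Un_Int[of "span W" ?K] by simp
    moreover have "dim ?K \<le> k"
      using dim_Un_set_le[of "{}" xs] xs by (simp add: independent_tuples_def)
    ultimately have k: "dim ?K = k" "dim (span W \<inter> ?K) = 0"
      by linarith+
    then have "?K \<inter> span W = {0}"
      by (auto simp: span_zero)
    moreover have "?K \<subseteq> S"
      using xs S by (intro span_minimal) (auto simp: independent_tuples_def)
    ultimately have "?K \<in> ?D"
      using k by (simp add: disjoint_subspaces_def)
    moreover have "xs \<in> independent_tuples {} ?K k"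
      using xs k by (auto simp: independent_tuples_def span_base)
    ultimately show "xs \<in> (\<Union>K\<in>?D. independent_tuples {} K k)" by blast
  next
    fix xs assume "xs \<in> (\<Union>K\<in>?D. independent_tuples {} K k)"
    then obtain K where K: "subspace K" "dim K = k" "K \<subseteq> S" "K \<inter> span W = {0}"
      and xs: "length xs = k" "set xs \<subseteq> K" "dim (set xs) = k"
      by (auto simp: disjoint_subspaces_def independent_tuples_def)
    have eq: "span (set xs) = K"
      using K xs by (intro subspace_dim_equal span_minimal) auto
    have "span (W \<union> set xs) = span (span W \<union> K)"
      by (simp add: span_Un span_span eq[symmetric])
    then have "dim (W \<union> set xs) = dim (span W \<union> K)"
      by (metis dim_span)
    also have "\<dots> = dim W + k"
      using dim_Un_Int[of "span W" K] K by (simp add: Int_commute)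
    finally show "xs \<in> independent_tuples W S k"
      using xs K by (auto simp: independent_tuples_def)
  qed
  have "card (independent_tuples W S k) = (\<Sum>K\<in>?D. card (independent_tuples {} K k))"
    unfolding un
  proof (rule card_UN_disjoint)
    show "\<forall>K\<in>?D. \<forall>L\<in>?D. K \<noteq> L \<longrightarrow> independent_tuples {} K k \<inter> independent_tuples {} L k = {}"
    proof (intro ballI impI, rule ccontr)
      fix K L assume KL: "K \<in> ?D" "L \<in> ?D" "K \<noteq> L"
        and "independent_tuples {} K k \<inter> independent_tuples {} L k \<noteq> {}"
      then obtain xs where xs: "set xs \<subseteq> K" "set xs \<subseteq> L" "dim (set xs) = k"
        by (auto simp: independent_tuples_def)
      have "span (set xs) = K" "span (set xs) = L"
        using KL xs by (intro subspace_dim_equal span_minimal; auto simp: disjoint_subspaces_def)+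
      then show False using KL by simp
    qed
  qed (auto simp: finite_vector_sets finite_independent_tuples)
  then have "real (card (independent_tuples W S k)) = (\<Sum>K\<in>?D. real (card (independent_tuples {} K k)))"
    by simp
  also have "\<dots> = (\<Sum>K\<in>?D. \<Prod>i<k. real q ^ k - real q ^ i)"
    by (rule sum.cong) (auto simp: card_independent_tuples disjoint_subspaces_def)
  finally have "(\<Prod>i<k. real q ^ dim S - real q ^ (dim W + i)) =
      real (card ?D) * (\<Prod>i<k. real q ^ k - real q ^ i)"
    using assms by (simp add: card_independent_tuples)
  moreover have "(\<Prod>i<k. real q ^ k - real q ^ i) \<noteq> 0"
    using q_ge_2 by (auto simp: power_inject_exp)
  ultimately show ?thesis
    by (simp add: prod_dividef)
qed

section \<open>Gaussian binomial coefficients as numbers of subspaces\<close>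

lemma gauss_binomial_eq:
  assumes "k \<le> m"
  shows "gauss_binomial q m k = (\<Prod>i<k. (real q ^ m - real q ^ i) / (real q ^ k - real q ^ i))"
  unfolding gauss_binomial_def
proof (rule prod.cong[OF refl])
  fix i assume "i \<in> {..<k}"
  then have "i \<le> k" "i \<le> m" using assms by auto
  then have "real q ^ m - real q ^ i = real q ^ i * (real q ^ (m - i) - 1)"
    "real q ^ k - real q ^ i = real q ^ i * (real q ^ (k - i) - 1)"
    by (auto simp: algebra_simps simp flip: power_add)
  then show "(real q ^ (m - i) - 1) / (real q ^ (k - i) - 1) =
      (real q ^ m - real q ^ i) / (real q ^ k - real q ^ i)"
    using q_ge_2 by simp
qed

lemma card_subspaces_in:
  assumes "subspace S" "k \<le> dim S"
  shows "real (card {K. subspace K \<and> dim K = k \<and> K \<subseteq> S}) = gauss_binomial q (dim S) k"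
proof -
  have "{K. subspace K \<and> dim K = k \<and> K \<subseteq> S} = disjoint_subspaces {} S k"
    by (auto simp: disjoint_subspaces_def subspace_0)
  then show ?thesis
    using card_disjoint_subspaces[of S "{}" k] assms by (simp add: gauss_binomial_eq)
qed

lemma card_subspaces_of_dim:
  "k \<le> n \<Longrightarrow> real (card (subspaces_of_dim scale k)) = gauss_binomial q n k"
  using card_subspaces_in[of UNIV k] by (simp add: subspaces_of_dim_def)

lemma gauss_binomial_1: "gauss_binomial q m 1 = (real q ^ m - 1) / (real q - 1)"
  by (simp add: gauss_binomial_def)

text \<open>The product for the Gaussian coefficient of \<open>Suc l\<close> over \<open>l\<close>
  telescopes and leaves only its extreme terms, which is the symmetry with the coefficient over
  \<open>1\<close>.\<close>

lemma card_hyperplanes: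
  assumes "subspace S" "dim S = Suc l"
  shows "real (card {K. subspace K \<and> dim K = l \<and> K \<subseteq> S}) = gauss_binomial q (Suc l) 1"
proof -
  let ?f = "\<lambda>i. 1 / (real q ^ (Suc l - i) - 1)"
  have nz: "real q ^ j - 1 \<noteq> 0" if "0 < j" for j
  proof -
    have "1 < real q ^ j"
      using q_ge_2 that by (intro one_less_power) auto
    then show ?thesis by simp
  qed
  have "gauss_binomial q (Suc l) l = (\<Prod>i<l. ?f (Suc i) / ?f i)"
    by (simp add: gauss_binomial_def Suc_diff_le)
  also have "\<dots> = ?f l / ?f 0"
    by (rule prod_lessThan_telescope) (use nz in auto)
  finally show ?thesis
    unfolding gauss_binomial_1 using card_subspaces_in[OF assms(1), of l] assms(2) by simp
qed

text \<open>The covers of \<open>U\<close> partition the vectors outside \<open>U\<close>, since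
  such a vector \<open>v\<close> lies in the single cover \<open>span (insert v U)\<close>. Each
  cover takes \<open>q ^ Suc l - q ^ l\<close> of them.\<close>

lemma card_superspaces:
  assumes "subspace U" "dim U = l" "l < n"
  shows "real (card {G \<in> subspaces_of_dim scale (Suc l). U \<subseteq> G}) = gauss_binomial q (n - l) 1"
proof -
  let ?G = "{G \<in> subspaces_of_dim scale (Suc l). U \<subseteq> G}"
  have sp: "span (insert v U) = G" if "G \<in> ?G" "v \<in> G - U" for G v
    using that assms
    by (intro subspace_dim_equal span_minimal) (auto simp: subspaces_of_dim_def dim_insert span_eq_iff[THEN iffD2])
  have "- U = (\<Union>G\<in>?G. G - U)"
  proof (intro set_eqI iffI)
    fix v assume v: "v \<in> - U"
    have "span (insert v U) \<in> ?G"
      using v assms by (auto simp: subspaces_of_dim_def dim_insert span_eq_iff[THEN iffD2] intro: span_base)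
    moreover have "v \<in> span (insert v U)" by (simp add: span_base)
    ultimately show "v \<in> (\<Union>G\<in>?G. G - U)" using v by blast
  qed auto
  then have "card (- U) = (\<Sum>G\<in>?G. card (G - U))"
  proof (simp only:, intro card_UN_disjoint ballI impI)
    fix G G' assume "G \<in> ?G" "G' \<in> ?G" "G \<noteq> G'"
    then show "(G - U) \<inter> (G' - U) = {}"
      using sp by (metis Int_iff ex_in_conv)
  qed (auto simp: finite_vectors finite_vector_sets)
  then have "real (card (- U)) = (\<Sum>G\<in>?G. real (card (G - U)))" by simp
  also have "\<dots> = (\<Sum>G\<in>?G. real q ^ Suc l - real q ^ l)"
  proof (rule sum.cong[OF refl])
    fix G assume "G \<in> ?G"
    then have "subspace G" "dim G = Suc l" "U \<subseteq> G" by (auto simp: subspaces_of_dim_def)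
    then show "real (card (G - U)) = real q ^ Suc l - real q ^ l"
      using assms card_mono[of G U]
      by (simp add: card_Diff_subset finite_vectors of_nat_diff card_subspace del: power_Suc)
  qed
  also have "\<dots> = real (card ?G) * (real q ^ Suc l - real q ^ l)" by simp
  also have "real (card (- U)) = real q ^ n - real q ^ l"
    using assms card_mono[of UNIV U] card_subspace[of UNIV]
    by (simp add: Compl_eq_Diff_UNIV card_Diff_subset finite_vectors of_nat_diff card_subspace)
  finally have "real (card ?G) * (real q ^ Suc l - real q ^ l) = real q ^ n - real q ^ l" by simp
  moreover have "real q ^ n = real q ^ l * real q ^ (n - l)"
    using assms by (simp flip: power_add)
  ultimately have "real (card ?G) * (real q - 1) * real q ^ l = (real q ^ (n - l) - 1) * real q ^ l"
    by (simp add: algebra_simps)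
  then have "real (card ?G) * (real q - 1) = real q ^ (n - l) - 1"
    using q_ge_2 by simp
  then show ?thesis
    unfolding gauss_binomial_1 using q_ge_2 by (simp add: field_simps)
qed

subsection \<open>Shadows of intersecting families\<close>

text \<open>Descends from \<open>I + \<langle>v\<rangle>\<close> to \<open>I\<close>, summing over all vectors \<open>v \<notin> I\<close>.\<close>

lemma sum_above_eq_0:
  fixes x :: "'b set \<Rightarrow> real"
  assumes H: "\<H> \<subseteq> subspaces_of_dim scale (Suc u)"
    and zero: "\<And>D. subspace D \<Longrightarrow> dim D = u \<Longrightarrow> (\<Sum>F | F \<in> \<H> \<and> D \<subseteq> F. x F) = 0"
    and I: "subspace I" "dim I + k = u"
  shows "(\<Sum>F | F \<in> \<H> \<and> I \<subseteq> F. x F) = 0"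
  using I
proof (induction k arbitrary: I)
  case 0
  then show ?case using zero by simp
next
  case (Suc k)
  let ?A = "{F \<in> \<H>. I \<subseteq> F}"
  have dim: "subspace F" "dim F = Suc u" if "F \<in> \<H>" for F
    using that H by (auto simp: subspaces_of_dim_def)
  have "(\<Sum>F\<in>?A. x F) * (real q ^ Suc u - real q ^ dim I) = (\<Sum>F\<in>?A. \<Sum>v | v \<in> - I \<and> v \<in> F. x F)"
    unfolding sum_distrib_right
  proof (rule sum.cong[OF refl])
    fix F assume F: "F \<in> ?A"
    have "{v. v \<in> - I \<and> v \<in> F} = F - I" by auto
    moreover have "real (card (F - I)) = real q ^ Suc u - real q ^ dim I"
      using F Suc.prems dim card_mono[of F I]
      by (simp add: card_Diff_subset finite_vectors of_nat_diff card_subspace del: power_Suc)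
    ultimately show "x F * (real q ^ Suc u - real q ^ dim I) = (\<Sum>v | v \<in> - I \<and> v \<in> F. x F)"
      by simp
  qed
  also have "\<dots> = (\<Sum>v\<in>- I. \<Sum>F | F \<in> ?A \<and> v \<in> F. x F)"
    by (rule sum.swap_restrict) (auto simp: finite_vectors finite_vector_sets)
  also have "\<dots> = 0"
  proof (rule sum.neutral, rule ballI)
    fix v assume v: "v \<in> - I"
    let ?J = "span (insert v I)"
    have "{F. F \<in> ?A \<and> v \<in> F} = {F \<in> \<H>. ?J \<subseteq> F}"
      using dim(1) by (auto intro: span_base dest: span_minimal[THEN subsetD, rotated 2])
    moreover have "dim ?J + k = u"
      using v Suc.prems by (simp add: dim_insert span_eq_iff[THEN iffD2])
    ultimately show "(\<Sum>F | F \<in> ?A \<and> v \<in> F. x F) = 0"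
      using Suc.IH[of ?J] by simp
  qed
  finally show ?case
    using Suc.prems q_ge_2 by (auto simp: power_inject_exp simp del: power_Suc)
qed

text \<open>\<open>|F \<inter> F0|^r\<close> counts the \<open>r\<close>-tuples in \<open>F0\<close> that lie in \<open>F\<close>; each spans a space of
  dimension at most \<open>u\<close>.\<close>

lemma sum_card_Int_power_eq_0:
  fixes x :: "'b set \<Rightarrow> real"
  assumes H: "\<H> \<subseteq> subspaces_of_dim scale (Suc u)"
    and zero: "\<And>D. subspace D \<Longrightarrow> dim D = u \<Longrightarrow> (\<Sum>F | F \<in> \<H> \<and> D \<subseteq> F. x F) = 0"
    and r: "r \<le> u"
  shows "(\<Sum>F\<in>\<H>. x F * real (card (F \<inter> F0)) ^ r) = 0"
proof -
  let ?L = "{vs. set vs \<subseteq> F0 \<and> length vs = r}"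
  have "(\<Sum>F\<in>\<H>. x F * real (card (F \<inter> F0)) ^ r) = (\<Sum>F\<in>\<H>. \<Sum>vs | vs \<in> ?L \<and> set vs \<subseteq> F. x F)"
  proof (rule sum.cong[OF refl])
    fix F assume "F \<in> \<H>"
    have "{vs. vs \<in> ?L \<and> set vs \<subseteq> F} = {vs. set vs \<subseteq> F \<inter> F0 \<and> length vs = r}"
      by auto
    then have "card {vs. vs \<in> ?L \<and> set vs \<subseteq> F} = card (F \<inter> F0) ^ r"
      by (simp only: card_lists_length_eq finite_vectors)
    then show "x F * real (card (F \<inter> F0)) ^ r = (\<Sum>vs | vs \<in> ?L \<and> set vs \<subseteq> F. x F)"
      by simp
  qed
  also have "\<dots> = (\<Sum>vs\<in>?L. \<Sum>F | F \<in> \<H> \<and> set vs \<subseteq> F. x F)"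
    by (rule sum.swap_restrict) (auto simp: finite_vectors finite_vector_sets finite_lists_length_eq)
  also have "\<dots> = 0"
  proof (rule sum.neutral, rule ballI)
    fix vs assume vs: "vs \<in> ?L"
    let ?J = "span (set vs)"
    have "{F. F \<in> \<H> \<and> set vs \<subseteq> F} = {F. F \<in> \<H> \<and> ?J \<subseteq> F}"
      using H span_superset[of "set vs"] by (auto simp: subspaces_of_dim_def dest: span_minimal[THEN subsetD, rotated 2])
    moreover have "dim ?J \<le> u"
      using dim_Un_set_le[of "{}" vs] vs r by simp
    then have "(\<Sum>F | F \<in> \<H> \<and> ?J \<subseteq> F. x F) = 0"
      by (intro sum_above_eq_0[OF H zero, where k = "u - dim ?J"]) auto
    ultimately show "(\<Sum>F | F \<in> \<H> \<and> set vs \<subseteq> F. x F) = 0" by simp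
  qed
  finally show ?thesis .
qed

text \<open>A kernel vector \<open>x\<close> of the incidence matrix annihilates every polynomial of degree at most \<open>u\<close>
  in \<open>|F \<inter> F0|\<close>. The one with roots \<open>q, \<dots>, q^u\<close> isolates \<open>F = F0\<close>, because all
  intersections are nonzero.\<close>

lemma card_le_card_shadow:
  assumes H: "\<H> \<subseteq> subspaces_of_dim scale (Suc u)"
    and int: "\<And>F F'. F \<in> \<H> \<Longrightarrow> F' \<in> \<H> \<Longrightarrow> 1 \<le> dim (F \<inter> F')"
  shows "card \<H> \<le> card (shadow scale (Suc u) \<H>)"
proof (rule ccontr)
  let ?S = "shadow scale (Suc u) \<H>"
  let ?M = "\<lambda>D F. if D \<subseteq> F then 1 else 0 :: real"
  assume "\<not> ?thesis"
  then obtain x where x: "\<exists>F\<in>\<H>. x F \<noteq> 0" and eq: "\<And>D. D \<in> ?S \<Longrightarrow> (\<Sum>F\<in>\<H>. ?M D F * x F) = 0"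
    using underdetermined_system[of ?S \<H> ?M] by (auto simp: finite_vector_sets)
  \<comment> \<open>The kernel equations range over the shadow only; a \<open>u\<close>-dimensional
    space outside it lies in no member, so its sum is empty.\<close>
  have zero: "(\<Sum>F | F \<in> \<H> \<and> D \<subseteq> F. x F) = 0" if D: "subspace D" "dim D = u" for D
  proof (cases "D \<in> ?S")
    case True
    have "(\<Sum>F\<in>\<H>. ?M D F * x F) = (\<Sum>F | F \<in> \<H> \<and> D \<subseteq> F. x F)"
      by (rule sum.mono_neutral_cong_right) (auto simp: finite_vector_sets)
    then show ?thesis using eq[OF True] by simp
  next
    case False
    then have "{F. F \<in> \<H> \<and> D \<subseteq> F} = {}"
      using D by (auto simp: shadow_def)
    then show ?thesis by (simp only: sum.empty)
  qed
  obtain F0 where F0: "F0 \<in> \<H>" "x F0 \<noteq> 0" using x by blast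
  let ?p = "\<lambda>F. \<Prod>j\<in>{1..u}. real (card (F \<inter> F0)) - real q ^ j"
  have dim: "subspace F" "dim F = Suc u" if "F \<in> \<H>" for F
    using that H by (auto simp: subspaces_of_dim_def)
  have card: "real (card (F \<inter> F0)) = real q ^ dim (F \<inter> F0)" if "F \<in> \<H>" for F
    using dim that F0 by (simp add: card_subspace subspace_inter)
  have "(\<Sum>F\<in>\<H>. x F * real (card (F \<inter> F0)) ^ 0 * ?p F) = 0"
    by (rule sum_power_mult_prod_eq_0[where m = u])
      (auto intro!: sum_card_Int_power_eq_0[OF H zero])
  moreover have "?p F = 0" if F: "F \<in> \<H> - {F0}" for F
  proof -
    have "dim (F \<inter> F0) \<noteq> Suc u"
    proof
      assume "dim (F \<inter> F0) = Suc u"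
      then have "F \<inter> F0 = F" "F \<inter> F0 = F0"
        using F F0 dim by (intro subspace_dim_equal; auto intro: subspace_inter)+
      then show False using F by auto
    qed
    moreover have "dim (F \<inter> F0) \<le> Suc u"
      using dim_subset[of "F \<inter> F0" F0] dim F0 by auto
    ultimately have "dim (F \<inter> F0) \<in> {1..u}"
      using int[of F F0] F F0 by auto
    then show ?thesis
      using card[of F] F by (auto simp: prod_zero_iff)
  qed
  then have "(\<Sum>F\<in>\<H> - {F0}. x F * real (card (F \<inter> F0)) ^ 0 * ?p F) = 0"
    by (intro sum.neutral) auto
  ultimately have "x F0 * ?p F0 = 0"
    using sum.remove[OF finite_vector_sets F0(1), of "\<lambda>F. x F * real (card (F \<inter> F0)) ^ 0 * ?p F"]
    by simp
  \<comment> \<open>\<open>F0\<close> itself has \<open>q ^ Suc u\<close> elements, and the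
    exponents of the roots stop at \<open>u\<close>.\<close>
  moreover have "?p F0 \<noteq> 0"
    using card[OF F0(1)] dim F0 q_ge_2 by (auto simp: power_inject_exp simp del: power_Suc)
  ultimately show False using F0 by simp
qed

subsection \<open>Upper shadows\<close>

text \<open>Splits the number of covers of a space into one plus the defect \<open>q[n-d,1]\<close>
  of the theorem: exchanging a single space for its covers gains exactly the second summand.\<close>

lemma gauss_binomial_Suc_1: "gauss_binomial q (Suc m) 1 = 1 + real q * gauss_binomial q m 1"
  unfolding gauss_binomial_1 using q_ge_2 by (simp add: field_simps)

lemma gauss_binomial_1_less: "m < k \<Longrightarrow> gauss_binomial q m 1 < gauss_binomial q k 1"
  unfolding gauss_binomial_1 using q_ge_2 by (simp add: divide_strict_right_mono)

lemma gauss_binomial_1_nonneg: "0 \<le> gauss_binomial q m 1"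
  unfolding gauss_binomial_1 using q_ge_2 by simp

text \<open>As in \<open>shadow\<close>, the index is the dimension of the members of the given
  family, not that of the result.\<close>

definition upper_shadow :: "nat \<Rightarrow> 'b set set \<Rightarrow> 'b set set" where
  "upper_shadow l \<H> = {G \<in> subspaces_of_dim scale (Suc l). \<exists>H\<in>\<H>. H \<subseteq> G}"

lemma card_upper_shadow_singleton:
  assumes "U \<in> subspaces_of_dim scale l" "l < n"
  shows "real (card (upper_shadow l {U})) = 1 + real q * gauss_binomial q (n - Suc l) 1"
proof -
  have "n - l = Suc (n - Suc l)" using assms by simp
  then show ?thesis
    using card_superspaces[of U l] assms gauss_binomial_Suc_1[of "n - Suc l"]
    by (simp add: upper_shadow_def subspaces_of_dim_def)
qed

text \<open>Fix a member \<open>U\<close>. Every other member shares at most one cover with \<open>U\<close>, so double counting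
  outside the upper shadow of \<open>U\<close> still gains on the remaining members.\<close>

lemma upper_shadow_bound:
  assumes H: "\<H> \<subseteq> subspaces_of_dim scale l" "\<H> \<noteq> {}" and l: "2 * l + 3 \<le> n"
  shows "real (card \<H>) + real q * gauss_binomial q (n - Suc l) 1 \<le> real (card (upper_shadow l \<H>)) \<and>
    (real (card \<H>) + real q * gauss_binomial q (n - Suc l) 1 = real (card (upper_shadow l \<H>)) \<longrightarrow>
      card \<H> = 1)"
proof -
  let ?N = "real q * gauss_binomial q (n - Suc l) 1"
  obtain U where U: "U \<in> \<H>" using H by blast
  define A where "A = \<H> - {U}"
  define E where "E = upper_shadow l \<H> - upper_shadow l {U}"
  have dim: "subspace K" "dim K = l" if "K \<in> \<H>" for K
    using that H by (auto simp: subspaces_of_dim_def)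
  have cU: "real (card (upper_shadow l {U})) = 1 + ?N"
    using H U l by (intro card_upper_shadow_singleton) auto
  have "upper_shadow l {U} \<subseteq> upper_shadow l \<H>"
    using U by (auto simp: upper_shadow_def)
  then have cE: "real (card (upper_shadow l \<H>)) = 1 + ?N + real (card E)"
    using cU card_mono[OF finite_vector_sets, of "upper_shadow l {U}" "upper_shadow l \<H>"]
    by (simp add: E_def card_Diff_subset finite_vector_sets of_nat_diff)
  have cA: "real (card \<H>) = 1 + real (card A)"
  proof -
    have "card \<H> = Suc (card A)"
      unfolding A_def using U finite_vector_sets by (metis card_Suc_Diff1)
    then show ?thesis by simp
  qed
  have low: "?N \<le> real (card {G \<in> E. K \<subseteq> G})" if K: "K \<in> A" for K
  proof -
    let ?S = "upper_shadow l {K}"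
    have Kl: "K \<in> \<H>" "K \<noteq> U" using K by (auto simp: A_def)
    have "G = span (K \<union> U)" if G: "G \<in> ?S" "U \<subseteq> G" for G
    proof (rule subspace_dim_equal[symmetric])
      have "K \<inter> U \<noteq> K"
        using Kl dim U subspace_dim_equal[of K U] by auto
      then have "dim (K \<inter> U) < l"
        using dim[OF Kl(1)] dim[OF U] subspace_dim_equal[of "K \<inter> U" K] subspace_inter[of K U]
        by (metis Int_lower1 not_le)
      then have "dim (K \<union> U) \<ge> Suc l"
        using dim_Un_Int[of K U] dim[OF Kl(1)] dim[OF U] by linarith
      then show "dim G \<le> dim (span (K \<union> U))"
        using G by (simp add: upper_shadow_def subspaces_of_dim_def)
      show "span (K \<union> U) \<subseteq> G"
        using G by (intro span_minimal) (auto simp: upper_shadow_def subspaces_of_dim_def)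
    qed (use G in \<open>auto simp: upper_shadow_def subspaces_of_dim_def\<close>)
    then have "?S - {span (K \<union> U)} \<subseteq> {G \<in> E. K \<subseteq> G}"
      using Kl by (auto simp: E_def upper_shadow_def)
    then have "card (?S - {span (K \<union> U)}) \<le> card {G \<in> E. K \<subseteq> G}"
      by (rule card_mono[OF finite_vector_sets])
    moreover have "real (card ?S) = 1 + ?N"
      using H Kl l by (intro card_upper_shadow_singleton) auto
    moreover have "card ?S \<le> Suc (card (?S - {span (K \<union> U)}))"
      using card_gt_0_iff[of ?S] finite_vector_sets by (auto simp: card_Diff_singleton_if)
    ultimately show ?thesis by linarith
  qed
  have high: "real (card {K \<in> A. K \<subseteq> G}) \<le> gauss_binomial q (Suc l) 1" if G: "G \<in> E" for G
  proof -
    have Gd: "subspace G" "dim G = Suc l"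
      using G by (auto simp: E_def upper_shadow_def subspaces_of_dim_def)
    have "card {K \<in> A. K \<subseteq> G} \<le> card {K. subspace K \<and> dim K = l \<and> K \<subseteq> G}"
      by (rule card_mono[OF finite_vector_sets]) (auto simp: A_def dim)
    then show ?thesis using card_hyperplanes[OF Gd] by linarith
  qed
  \<comment> \<open>The hypothesis \<open>2 * l + 3 \<le> n\<close> says
    \<open>Suc l < n - Suc l\<close>. Hence a member of \<open>A\<close> has more covers in
    \<open>E\<close> than an element of \<open>E\<close> contains members of
    \<open>A\<close>.\<close>
  have lt: "gauss_binomial q (Suc l) 1 < ?N"
  proof -
    have "gauss_binomial q (Suc l) 1 < gauss_binomial q (n - Suc l) 1"
      using l by (intro gauss_binomial_1_less) auto
    also have "\<dots> \<le> ?N"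
      using q_ge_2 gauss_binomial_1_nonneg[of "n - Suc l"] mult_right_mono[of 1 "real q" "gauss_binomial q (n - Suc l) 1"] by simp
    finally show ?thesis .
  qed
  have "real (card A) * ?N = (\<Sum>K\<in>A. ?N)" by simp
  also have "\<dots> \<le> (\<Sum>K\<in>A. real (card {G \<in> E. K \<subseteq> G}))"
    by (rule sum_mono) (rule low)
  also have "\<dots> = real (\<Sum>K\<in>A. card {G \<in> E. K \<subseteq> G})" by simp
  also have "(\<Sum>K\<in>A. card {G \<in> E. K \<subseteq> G}) = (\<Sum>G\<in>E. card {K \<in> A. K \<subseteq> G})"
    by (rule sum_multicount_gen) (auto simp: finite_vector_sets)
  also have "real \<dots> = (\<Sum>G\<in>E. real (card {K \<in> A. K \<subseteq> G}))" by simp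
  also have "\<dots> \<le> (\<Sum>G\<in>E. gauss_binomial q (Suc l) 1)"
    by (rule sum_mono) (rule high)
  finally have dc: "real (card A) * ?N \<le> real (card E) * gauss_binomial q (Suc l) 1" by simp
  have pos: "0 < ?N" using lt gauss_binomial_1_nonneg[of "Suc l"] by linarith
  \<comment> \<open>The double count is strict as soon as a second member exists, so equality in the
    bound leaves only \<open>U\<close>.\<close>
  have "real (card A) < real (card E)" if "A \<noteq> {}"
  proof (rule ccontr)
    assume "\<not> ?thesis"
    then have "real (card E) * gauss_binomial q (Suc l) 1 \<le> real (card A) * gauss_binomial q (Suc l) 1"
      using gauss_binomial_1_nonneg by (intro mult_right_mono) auto
    also have "\<dots> < real (card A) * ?N"
      using lt that by (simp add: card_gt_0_iff finite_vector_sets)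
    finally show False using dc by simp
  qed
  then show ?thesis
    using cE cA by (cases "A = {}") auto
qed

section \<open>Moving the levels of an antichain towards dimension \<open>d\<close>\<close>

lemma s_union_iff:
  assumes "\<F> \<subseteq> all_subspaces scale"
  shows "s_union scale s \<F> \<longleftrightarrow> (\<forall>F\<in>\<F>. \<forall>F'\<in>\<F>. dim (F \<union> F') \<le> s)"
proof -
  have "dim {x + y |x y. x \<in> F \<and> y \<in> F'} = dim (F \<union> F')" if "F \<in> \<F>" "F' \<in> \<F>" for F F'
  proof -
    have "subspace F" "subspace F'"
      using that assms by (auto simp: all_subspaces_def)
    then have "span (F \<union> F') = {x + y |x y. x \<in> F \<and> y \<in> F'}"
      by (simp add: span_Un span_eq_iff[THEN iffD2])
    then show ?thesis by (metis dim_span)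
  qed
  then show ?thesis by (simp add: s_union_def)
qed

text \<open>Induction on the height \<open>k\<close> above \<open>d\<close>: the top level is
  exchanged for its shadow, which is no smaller. Two facts are carried along for the equality cases:
  the new members lie below old ones, and old members of dimension less than \<open>d\<close>
  survive.\<close>

lemma push_down:
  assumes "\<F> \<subseteq> all_subspaces scale" "subspace_antichain \<F>" "s_union scale s \<F>"
    and s: "s \<le> 2 * d + 1" and "\<forall>F\<in>\<F>. dim F \<le> d + k"
  shows "\<exists>\<G>. \<G> \<subseteq> all_subspaces scale \<and> subspace_antichain \<G> \<and> (\<forall>G\<in>\<G>. dim G \<le> d) \<and>
    card \<F> \<le> card \<G> \<and> (\<forall>G\<in>\<G>. \<exists>F\<in>\<F>. G \<subseteq> F) \<and> {F \<in> \<F>. dim F < d} \<subseteq> \<G>"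
  using assms(1,2,3,5)
proof (induction k arbitrary: \<F>)
  case 0
  then show ?case by (intro exI[of _ \<F>]) auto
next
  case (Suc k)
  note sub = Suc.prems(1) and un = Suc.prems(3)[unfolded s_union_iff[OF Suc.prems(1)]]
  have anti: "F = F'" if "F \<in> \<F>" "F' \<in> \<F>" "F \<subseteq> F'" for F F'
    using that Suc.prems(2) by (auto simp: subspace_antichain_def)
  define u where "u = d + k"
  define T where "T = {F \<in> \<F>. dim F = Suc u}"
  define \<F>' where "\<F>' = (\<F> - T) \<union> shadow scale (Suc u) T"
  have ss: "subspace F" if "F \<in> \<F>" for F using that sub by (auto simp: all_subspaces_def)
  have below: "dim F \<le> u" if "F \<in> \<F> - T" for F
    using that Suc.prems(4) by (force simp: T_def u_def)
  have shD: "subspace G" "dim G = u" "\<exists>Z\<in>T. G \<subseteq> Z" if "G \<in> shadow scale (Suc u) T" for G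
    using that by (auto simp: shadow_def)
  have sub': "\<F>' \<subseteq> all_subspaces scale"
    using sub shD by (auto simp: \<F>'_def all_subspaces_def)
  have dom: "\<exists>F\<in>\<F>. G \<subseteq> F" if "G \<in> \<F>'" for G
    using that shD(3)[of G] by (auto simp: \<F>'_def T_def)
  have "subspace_antichain \<F>'"
    unfolding subspace_antichain_def
  proof (intro ballI impI notI)
    fix X Y assume XY: "X \<in> \<F>'" "Y \<in> \<F>'" "X \<noteq> Y" "X \<subseteq> Y"
    have "dim Y \<le> u" using XY below shD(2) by (auto simp: \<F>'_def)
    then have "X \<notin> shadow scale (Suc u) T"
      using XY sub' shD subspace_dim_equal[of X Y] by (auto simp: all_subspaces_def)
    then have X: "X \<in> \<F> - T" using XY by (auto simp: \<F>'_def)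
    \<comment> \<open>\<open>X\<close> is an old member inside \<open>Y\<close>, and
      \<open>Y\<close> lies in an old member \<open>Z\<close>. The antichain property gives
      \<open>X = Z\<close>, so \<open>Y\<close> is squeezed between equal spaces.\<close>
    obtain Z where Z: "Z \<in> \<F>" "Y \<subseteq> Z" "Y \<in> \<F> \<or> Z \<in> T"
      using XY shD(3)[of Y] by (auto simp: \<F>'_def T_def)
    then have "X = Z" using anti X XY by blast
    then show False using XY Z X by auto
  qed
  moreover have "s_union scale s \<F>'"
    unfolding s_union_iff[OF sub']
  proof (intro ballI)
    fix X Y assume "X \<in> \<F>'" "Y \<in> \<F>'"
    then obtain X' Y' where "X' \<in> \<F>" "Y' \<in> \<F>" "X \<subseteq> X'" "Y \<subseteq> Y'"
      using dom by meson
    then show "dim (X \<union> Y) \<le> s"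
      using un dim_subset[of "X \<union> Y" "X' \<union> Y'"] by (meson Un_mono order_trans)
  qed
  moreover have "\<forall>F\<in>\<F>'. dim F \<le> d + k"
    using below shD(2) by (auto simp: \<F>'_def u_def)
  ultimately obtain \<G> where \<G>: "\<G> \<subseteq> all_subspaces scale" "subspace_antichain \<G>" "\<forall>G\<in>\<G>. dim G \<le> d"
      "card \<F>' \<le> card \<G>" "\<forall>G\<in>\<G>. \<exists>F\<in>\<F>'. G \<subseteq> F" "{F \<in> \<F>'. dim F < d} \<subseteq> \<G>"
    using Suc.IH[OF sub'] by blast
  have "card T \<le> card (shadow scale (Suc u) T)"
  proof (rule card_le_card_shadow)
    show "T \<subseteq> subspaces_of_dim scale (Suc u)"
      using ss by (auto simp: T_def subspaces_of_dim_def)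
    fix X Y assume "X \<in> T" "Y \<in> T"
    then have "dim (X \<union> Y) + dim (X \<inter> Y) = 2 * Suc u" "dim (X \<union> Y) \<le> s"
      using dim_Un_Int[of X Y] ss un by (auto simp: T_def)
    \<comment> \<open>The intersection has dimension at least \<open>2 * Suc u - s\<close>, which is
      at least \<open>2 * (d + 1) - (2 * d + 1) = 1\<close>.\<close>
    then show "1 \<le> dim (X \<inter> Y)" using s unfolding u_def by arith
  qed
  moreover have "(\<F> - T) \<inter> shadow scale (Suc u) T = {}"
    using anti by (auto simp: shadow_def T_def)
  then have "card \<F>' = card (\<F> - T) + card (shadow scale (Suc u) T)"
    unfolding \<F>'_def by (intro card_Un_disjoint finite_vector_sets)
  moreover have "card \<F> = card (\<F> - T) + card T"
  proof -
    have "\<F> = (\<F> - T) \<union> T" by (auto simp: T_def)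
    then show ?thesis by (metis card_Un_disjoint finite_vector_sets Diff_disjoint Int_commute)
  qed
  ultimately have "card \<F> \<le> card \<G>" using \<G>(4) by linarith
  moreover have "\<forall>G\<in>\<G>. \<exists>F\<in>\<F>. G \<subseteq> F"
    using \<G>(5) dom by (meson order_trans)
  moreover have "{F \<in> \<F>. dim F < d} \<subseteq> \<G>"
    using \<G>(6) by (auto simp: \<F>'_def T_def u_def)
  ultimately show ?case using \<G> by blast
qed

text \<open>Induction on the number of levels between the lowest possible dimension \<open>l\<close>
  and \<open>d - 1\<close>. Lifting a nonempty level below \<open>d - 1\<close> gains strictly, so
  equality can arise only when level \<open>d - 1\<close> is the lowest one; there the sharp bound
  for upper shadows decides.\<close>

lemma push_up:
  assumes "\<F> \<subseteq> all_subspaces scale" "subspace_antichain \<F>"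
    and "\<forall>F\<in>\<F>. dim F \<le> d" "\<exists>F\<in>\<F>. dim F < d" "\<forall>F\<in>\<F>. l \<le> dim F"
    and "l + Suc k = d" and n: "2 * d + 1 \<le> n"
  shows "real (card \<F>) \<le> gauss_binomial q n d - real q * gauss_binomial q (n - d) 1 \<and>
    (real (card \<F>) = gauss_binomial q n d - real q * gauss_binomial q (n - d) 1 \<longrightarrow>
      is_family_A scale (2 * d) \<F>)"
  using assms(1-6)
proof (induction k arbitrary: \<F> l)
  case 0
  note sub = "0.prems"(1) and l = "0.prems"(6)
  have anti: "F = F'" if "F \<in> \<F>" "F' \<in> \<F>" "F \<subseteq> F'" for F F'
    using that "0.prems"(2) by (auto simp: subspace_antichain_def)
  define T where "T = {F \<in> \<F>. dim F = l}"
  have T: "T \<subseteq> subspaces_of_dim scale l" "T \<noteq> {}"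
    using "0.prems" by (force simp: T_def subspaces_of_dim_def all_subspaces_def)+
  have up: "upper_shadow l T \<subseteq> subspaces_of_dim scale d"
    using l by (auto simp: upper_shadow_def)
  have rest: "\<F> - T \<subseteq> subspaces_of_dim scale d - upper_shadow l T"
  proof
    fix X assume X: "X \<in> \<F> - T"
    have "dim X \<le> d" "l \<le> dim X" using X "0.prems" by auto
    then have "dim X = d" using X l by (auto simp: T_def)
    moreover have "X \<notin> upper_shadow l T"
      using X anti by (auto simp: upper_shadow_def T_def)
    ultimately show "X \<in> subspaces_of_dim scale d - upper_shadow l T"
      using X sub by (auto simp: subspaces_of_dim_def all_subspaces_def)
  qed
  have cF: "card \<F> = card (\<F> - T) + card T"
  proof -
    have "\<F> = (\<F> - T) \<union> T" by (auto simp: T_def)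
    then show ?thesis by (metis card_Un_disjoint finite_vector_sets Diff_disjoint Int_commute)
  qed
  have cR: "card (\<F> - T) \<le> card (subspaces_of_dim scale d - upper_shadow l T)"
    by (rule card_mono[OF finite_vector_sets rest])
  have cD: "real (card (subspaces_of_dim scale d - upper_shadow l T)) =
      gauss_binomial q n d - real (card (upper_shadow l T))"
    using up card_mono[OF finite_vector_sets up] card_subspaces_of_dim[of d] n
    by (simp add: card_Diff_subset finite_vector_sets of_nat_diff)
  have nl: "n - Suc l = n - d" using l by simp
  note b = upper_shadow_bound[OF T, unfolded nl]
  have bound: "real (card T) + real q * gauss_binomial q (n - d) 1 \<le> real (card (upper_shadow l T))"
    and one: "real (card T) + real q * gauss_binomial q (n - d) 1 = real (card (upper_shadow l T)) \<Longrightarrow> card T = 1"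
    using b l n by auto
  show ?case
  proof (intro conjI impI)
    show "real (card \<F>) \<le> gauss_binomial q n d - real q * gauss_binomial q (n - d) 1"
      using bound cF cR cD by linarith
    assume eq: "real (card \<F>) = gauss_binomial q n d - real q * gauss_binomial q (n - d) 1"
    have "card T = 1"
      using bound cF cR cD eq by (intro one) linarith
    then obtain U where U: "T = {U}" by (auto simp: card_1_singleton_iff)
    have "card (\<F> - T) = card (subspaces_of_dim scale d - upper_shadow l T)"
      using bound cF cR cD eq by linarith
    then have "\<F> - T = subspaces_of_dim scale d - upper_shadow l T"
      using rest finite_vector_sets by (metis card_subset_eq)
    moreover have "upper_shadow l T = {F \<in> subspaces_of_dim scale d. U \<subseteq> F}"
      using U l by (auto simp: upper_shadow_def)
    moreover have "\<F> = (\<F> - T) \<union> {U}" using U by (auto simp: T_def)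
    ultimately have "\<F> = family_A scale (2 * d) U"
      by (simp add: family_A_def)
    \<comment> \<open>For the even value \<open>s = 2 * d\<close> the rounded-up half is
      \<open>d\<close>, so the fixed subspace has dimension \<open>d - 1 = l\<close>.\<close>
    moreover have "U \<in> subspaces_of_dim scale ((2 * d + 1) div 2 - 1)"
      using T U l by auto
    ultimately show "is_family_A scale (2 * d) \<F>"
      unfolding is_family_A_def by blast
  qed
next
  case (Suc k)
  note sub = Suc.prems(1) and l = Suc.prems(6)
  have anti: "F = F'" if "F \<in> \<F>" "F' \<in> \<F>" "F \<subseteq> F'" for F F'
    using that Suc.prems(2) by (auto simp: subspace_antichain_def)
  define T where "T = {F \<in> \<F>. dim F = l}"
  have above: "Suc l \<le> dim F" if "F \<in> \<F> - T" for F
    using that Suc.prems(5) by (force simp: T_def)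
  show ?case
  proof (cases "T = {}")
    case True
    then show ?thesis
      using above Suc.prems by (intro Suc.IH[of \<F> "Suc l"]) auto
  next
    case False
    have T: "T \<subseteq> subspaces_of_dim scale l"
      using sub by (auto simp: T_def subspaces_of_dim_def all_subspaces_def)
    define \<F>' where "\<F>' = (\<F> - T) \<union> upper_shadow l T"
    have upD: "subspace G" "dim G = Suc l" "\<exists>Z\<in>T. Z \<subseteq> G" if "G \<in> upper_shadow l T" for G
      using that by (auto simp: upper_shadow_def subspaces_of_dim_def)
    have sub': "\<F>' \<subseteq> all_subspaces scale"
      using sub upD by (auto simp: \<F>'_def all_subspaces_def)
    have anti': "subspace_antichain \<F>'"
      unfolding subspace_antichain_def
    proof (intro ballI impI notI)
      fix X Y assume XY: "X \<in> \<F>'" "Y \<in> \<F>'" "X \<noteq> Y" "X \<subseteq> Y"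
      have "Suc l \<le> dim X" using XY above upD(2) by (auto simp: \<F>'_def)
      then have "Y \<notin> upper_shadow l T"
        using XY sub' upD subspace_dim_equal[of X Y] by (auto simp: all_subspaces_def)
      then have Y: "Y \<in> \<F> - T" using XY by (auto simp: \<F>'_def)
      obtain Z where Z: "Z \<in> \<F>" "Z \<subseteq> X" "X \<in> \<F> \<or> Z \<in> T"
        using XY upD(3)[of X] by (auto simp: \<F>'_def T_def)
      then have "Z = Y" using anti Y XY by blast
      then show False using XY Z Y by auto
    qed
    have "real (card T) + real q * gauss_binomial q (n - Suc l) 1 \<le> real (card (upper_shadow l T))"
      using upper_shadow_bound[OF T False] l n by auto
    moreover have "0 < real q * gauss_binomial q (n - Suc l) 1"
      using q_ge_2 gauss_binomial_1_less[of 0 "n - Suc l"] gauss_binomial_1_nonneg[of 0] l n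
      by (intro mult_pos_pos) linarith+
    ultimately have up: "card T < card (upper_shadow l T)" by linarith
    have "(\<F> - T) \<inter> upper_shadow l T = {}"
      using anti by (auto simp: upper_shadow_def T_def)
    then have "card \<F>' = card (\<F> - T) + card (upper_shadow l T)"
      unfolding \<F>'_def by (intro card_Un_disjoint finite_vector_sets)
    moreover have "card \<F> = card (\<F> - T) + card T"
    proof -
      have "\<F> = (\<F> - T) \<union> T" by (auto simp: T_def)
      then show ?thesis by (metis card_Un_disjoint finite_vector_sets Diff_disjoint Int_commute)
    qed
    ultimately have lt: "card \<F> < card \<F>'" using up by linarith
    \<comment> \<open>The induction hypothesis asks for a member below dimension \<open>d\<close>;
      the lifted level has dimension \<open>Suc l < d\<close> and is not empty.\<close>
    have "upper_shadow l T \<noteq> {}" using up by auto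
    then obtain G where "G \<in> \<F>'" "dim G = Suc l" using upD by (auto simp: \<F>'_def)
    then have "\<exists>F\<in>\<F>'. dim F < d" using l by (intro bexI[of _ G]) auto
    moreover have "\<forall>F\<in>\<F>'. dim F \<le> d" "\<forall>F\<in>\<F>'. Suc l \<le> dim F"
      using Suc.prems(3) upD(2) above l by (auto simp: \<F>'_def)
    ultimately have "real (card \<F>') \<le> gauss_binomial q n d - real q * gauss_binomial q (n - d) 1"
      using Suc.IH[OF sub' anti', of "Suc l"] l by auto
    then show ?thesis using lt by linarith
  qed
qed

subsection \<open>Extremal families\<close>

text \<open>A \<open>c\<close>-dimensional part \<open>W'\<close> of \<open>W\<close> is enlarged to
  the span of an independent set \<open>X\<close> of size \<open>n - d\<close>. The complements of
  that span meet \<open>W'\<close> trivially, hence join with it to dimension \<open>d + c\<close>,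
  and each factor in their count equals \<open>q ^ (n - d)\<close>.\<close>

lemma many_subspaces_avoiding:
  assumes W: "subspace W" "c \<le> dim W" and c: "c + d \<le> n"
  shows "\<exists>\<D>. \<D> \<subseteq> subspaces_of_dim scale d \<and> card \<D> = q ^ (d * (n - d)) \<and>
    (\<forall>G\<in>\<D>. d + c \<le> dim (G \<union> W))"
proof -
  obtain W' where W': "subspace W'" "W' \<subseteq> span W" "dim W' = c"
    using choose_subspace_of_subspace[OF W(2)] by metis
  have W'W: "W' \<subseteq> W" using W' W by (simp add: span_eq_iff[THEN iffD2])
  obtain B where B: "finite B" "independent B" "span B = W'" "card B = c"
    using basis_subspace_exists[OF W'(1)] W'(3) by metis
  obtain C where C: "B \<subseteq> C" "independent C" "UNIV \<subseteq> span C"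
    using maximal_independent_subset_extend[of B UNIV] B by auto
  have "card C = n"
    using basis_card_eq_dim[of C UNIV] C by simp
  \<comment> \<open>This leaves room for \<open>n - d\<close> basis vectors that include the basis
    of \<open>W'\<close>.\<close>
  moreover have "c \<le> n - d" using c by simp
  ultimately obtain X where X: "B \<subseteq> X" "X \<subseteq> C" "card X = n - d"
    using exists_subset_between[of B "n - d" C] B C finite_vectors by auto
  have dX: "dim X = n - d"
    using X C by (metis dim_eq_card_independent independent_mono)
  have nd: "n = n - d + d" using c by simp
  let ?D = "disjoint_subspaces X UNIV d"
  have "real (card ?D) = (\<Prod>i<d. (real q ^ n - real q ^ (n - d + i)) / (real q ^ d - real q ^ i))"
    using card_disjoint_subspaces[of UNIV X d] dX by simp
  also have "\<dots> = (\<Prod>i<d. real q ^ (n - d))"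
  proof (rule prod.cong[OF refl])
    fix i assume "i \<in> {..<d}"
    then have "real q ^ i < real q ^ d" using q_ge_2 by (intro power_strict_increasing) auto
    moreover have "real q ^ n - real q ^ (n - d + i) = real q ^ (n - d) * (real q ^ d - real q ^ i)"
      using nd by (metis power_add right_diff_distrib)
    ultimately show "(real q ^ n - real q ^ (n - d + i)) / (real q ^ d - real q ^ i) = real q ^ (n - d)"
      by simp
  qed
  also have "\<dots> = real (q ^ (d * (n - d)))"
    by (simp add: mult.commute flip: power_mult)
  finally have "card ?D = q ^ (d * (n - d))" by (simp only: of_nat_eq_iff)
  moreover have "?D \<subseteq> subspaces_of_dim scale d"
    by (auto simp: disjoint_subspaces_def subspaces_of_dim_def)
  moreover have "d + c \<le> dim (G \<union> W)" if "G \<in> ?D" for G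
  proof -
    have "W' \<subseteq> span X" using B X span_mono by metis
    then have "G \<inter> W' \<subseteq> {0}" using that by (auto simp: disjoint_subspaces_def)
    then have "dim (G \<inter> W') = 0" by simp
    moreover have "dim (G \<union> W') + dim (G \<inter> W') = d + c"
      using dim_Un_Int[of G W'] that W' by (simp add: disjoint_subspaces_def)
    ultimately have "dim (G \<union> W') = d + c" by linarith
    then show ?thesis
      using dim_subset[of "G \<union> W'" "G \<union> W"] W'W by auto
  qed
  ultimately show ?thesis by blast
qed

text \<open>With \<open>c = s - d + 1\<close> the spaces just constructed join with \<open>W\<close>
  to dimension at least \<open>s + 1\<close>, whereas a space below some member of
  \<open>\<F>\<close> joins with \<open>W\<close> to dimension at most \<open>s\<close>.\<close>

lemma large_member_excludes:
  assumes sub: "\<F> \<subseteq> all_subspaces scale" and un: "s_union scale s \<F>"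
    and W: "W \<in> \<F>" "s < dim W + d" and s: "s < n" "d \<le> s"
    and dom: "\<forall>G\<in>\<G>. \<exists>F\<in>\<F>. G \<subseteq> F"
  shows "\<exists>\<D>. \<D> \<subseteq> subspaces_of_dim scale d \<and> card \<D> = q ^ (d * (n - d)) \<and> \<D> \<inter> \<G> = {}"
proof -
  have "subspace W" "s - d + 1 \<le> dim W" using W s sub by (auto simp: all_subspaces_def)
  then obtain \<D> where D: "\<D> \<subseteq> subspaces_of_dim scale d" "card \<D> = q ^ (d * (n - d))"
      and dim: "\<And>G. G \<in> \<D> \<Longrightarrow> d + (s - d + 1) \<le> dim (G \<union> W)"
    using many_subspaces_avoiding[of W "s - d + 1" d] s by auto
  have "G \<notin> \<G>" if G: "G \<in> \<D>" for G
  proof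
    assume "G \<in> \<G>"
    then obtain F where F: "F \<in> \<F>" "G \<subseteq> F" using dom by blast
    then have "dim (G \<union> W) \<le> dim (F \<union> W)" by (intro dim_subset) auto
    also have "\<dots> \<le> s" using un F W unfolding s_union_iff[OF sub] by blast
    finally show False using dim[OF G] s by linarith
  qed
  then show ?thesis using D by blast
qed

text \<open>A member of dimension less than \<open>d\<close> costs at least the positive amount
  \<open>q[n-d,1]\<close> by \<open>push_up\<close>, so equality confines the family to level
  \<open>d\<close> and then fills that level.\<close>

lemma low_antichain_bound:
  assumes "\<G> \<subseteq> all_subspaces scale" "subspace_antichain \<G>" "\<forall>G\<in>\<G>. dim G \<le> d"
    and n: "2 * d + 1 \<le> n"
  shows "real (card \<G>) \<le> gauss_binomial q n d \<and>
    (real (card \<G>) = gauss_binomial q n d \<longrightarrow> \<G> = subspaces_of_dim scale d)"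
proof (cases "\<exists>G\<in>\<G>. dim G < d")
  case True
  have "0 < real q * gauss_binomial q (n - d) 1"
    using q_ge_2 gauss_binomial_1_less[of 0 "n - d"] gauss_binomial_1_nonneg[of 0] n
    by (intro mult_pos_pos) linarith+
  moreover have "real (card \<G>) \<le> gauss_binomial q n d - real q * gauss_binomial q (n - d) 1"
    using push_up[of \<G> d 0 "d - 1"] assms True by auto
  ultimately show ?thesis by linarith
next
  case False
  then have "\<G> \<subseteq> subspaces_of_dim scale d"
    using assms by (force simp: all_subspaces_def subspaces_of_dim_def)
  moreover have "real (card (subspaces_of_dim scale d)) = gauss_binomial q n d"
    using n by (intro card_subspaces_of_dim) simp
  ultimately show ?thesis
    using card_mono[OF finite_vector_sets, of \<G> "subspaces_of_dim scale d"]
      card_subset_eq[OF finite_vector_sets, of \<G> "subspaces_of_dim scale d"] by auto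
qed

text \<open>\<open>U\<close> stands in for its \<open>1 + q[n-d,1]\<close> covers, a net loss of
  \<open>q[n-d,1]\<close>.\<close>

lemma card_family_A:
  assumes "is_family_A scale (2 * d) \<F>" "1 \<le> d" "d \<le> n"
  shows "real (card \<F>) = gauss_binomial q n d - real q * gauss_binomial q (n - d) 1"
proof -
  obtain l where l: "d = Suc l" using assms by (cases d) auto
  obtain U where U: "U \<in> subspaces_of_dim scale l" and F: "\<F> = family_A scale (2 * d) U"
    using assms l by (auto simp: is_family_A_def)
  have up: "upper_shadow l {U} = {F \<in> subspaces_of_dim scale d. U \<subseteq> F}"
    by (simp add: upper_shadow_def l)
  have F: "\<F> = insert U (subspaces_of_dim scale d - upper_shadow l {U})"
    unfolding F up by (simp add: family_A_def)
  have "U \<notin> subspaces_of_dim scale d" using U l by (simp add: subspaces_of_dim_def)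
  then have "card \<F> = Suc (card (subspaces_of_dim scale d - upper_shadow l {U}))"
    unfolding F using finite_vector_sets by simp
  also have "\<dots> = Suc (card (subspaces_of_dim scale d) - card (upper_shadow l {U}))"
    by (subst card_Diff_subset) (auto simp: finite_vector_sets up)
  finally have "card \<F> = Suc (card (subspaces_of_dim scale d) - card (upper_shadow l {U}))" .
  moreover have "card (upper_shadow l {U}) \<le> card (subspaces_of_dim scale d)"
    by (rule card_mono[OF finite_vector_sets]) (auto simp: up)
  ultimately show ?thesis
    using card_upper_shadow_singleton[OF U] card_subspaces_of_dim[of d] assms l
    by (simp add: of_nat_diff)
qed

text \<open>The left side, the number of covers of a \<open>(d-1)\<close>-dimensional space, is
  below \<open>q ^ Suc (n - d)\<close>, and \<open>Suc (n - d) \<le> 2 * (n - d)\<close>. So the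
  complements excluded by a large member outnumber these covers.\<close>

lemma superspace_count_less:
  assumes "2 \<le> d" "d < n"
  shows "1 + real q * gauss_binomial q (n - d) 1 < real (q ^ (d * (n - d)))"
proof -
  let ?m = "Suc (n - d)"
  have "gauss_binomial q ?m 1 \<le> (real q ^ ?m - 1) / 1"
    unfolding gauss_binomial_1 using q_ge_2 by (intro divide_left_mono) (auto simp del: power_Suc)
  also have "\<dots> < real q ^ ?m" by simp
  also have "\<dots> \<le> real q ^ (d * (n - d))"
  proof (rule power_increasing)
    have "?m \<le> 2 * (n - d)" using assms by simp
    also have "\<dots> \<le> d * (n - d)" using assms by (intro mult_right_mono) auto
    finally show "?m \<le> d * (n - d)" .
  qed (use q_ge_2 in auto)
  finally show ?thesis unfolding gauss_binomial_Suc_1 by simp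
qed

text \<open>Equality makes the pushed-down family consist of all \<open>d\<close>-dimensional spaces
  with \<open>d = s div 2\<close>. A member below \<open>d\<close> would have survived into it, and
  a member above \<open>s - d\<close> would have kept some \<open>d\<close>-dimensional space out of
  it.\<close>

lemma s_union_antichain_bound:
  assumes sub: "\<F> \<subseteq> all_subspaces scale" and anti: "subspace_antichain \<F>"
    and un: "s_union scale s \<F>" and s: "2 \<le> s" "s < n"
  shows "real (card \<F>) \<le> gauss_binomial q n (s div 2)"
    and "real (card \<F>) = gauss_binomial q n (s div 2) \<Longrightarrow>
      F \<in> \<F> \<Longrightarrow> s div 2 \<le> dim F \<and> dim F \<le> s - s div 2"
proof -
  define d where "d = s div 2"
  have d: "s \<le> 2 * d + 1" "2 * d \<le> s" "d \<le> s" "2 * d + 1 \<le> n" using s by (auto simp: d_def)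
  have "\<forall>F\<in>\<F>. dim F \<le> d + n" using dim_le_n by (simp add: trans_le_add2)
  then obtain \<G> where G: "\<G> \<subseteq> all_subspaces scale" "subspace_antichain \<G>" "\<forall>G\<in>\<G>. dim G \<le> d"
      "card \<F> \<le> card \<G>" and dom: "\<forall>G\<in>\<G>. \<exists>F\<in>\<F>. G \<subseteq> F" and low: "{F \<in> \<F>. dim F < d} \<subseteq> \<G>"
    using push_down[OF sub anti un d(1), of n] by auto
  note b = low_antichain_bound[OF G(1-3) d(4)]
  show "real (card \<F>) \<le> gauss_binomial q n (s div 2)"
    using b G(4) by (simp flip: d_def)
  assume eq: "real (card \<F>) = gauss_binomial q n (s div 2)" and F: "F \<in> \<F>"
  have G_eq: "\<G> = subspaces_of_dim scale d"
    using b G(4) eq by (simp flip: d_def)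
  have "d \<le> dim F"
    using low F G_eq by (force simp: subspaces_of_dim_def)
  moreover have "dim F \<le> s - d"
  proof (rule ccontr)
    assume "\<not> ?thesis"
    then have "s < dim F + d" using d by linarith
    then obtain \<D> where D: "\<D> \<subseteq> subspaces_of_dim scale d" "card \<D> = q ^ (d * (n - d))" "\<D> \<inter> \<G> = {}"
      using large_member_excludes[OF sub un F _ s(2) d(3) dom] by auto
    then have "\<D> = {}" using G_eq by blast
    then show False using D(2) q_ge_2 by simp
  qed
  ultimately show "s div 2 \<le> dim F \<and> dim F \<le> s - s div 2" by (simp add: d_def)
qed

text \<open>If no member exceeds dimension \<open>d\<close>, \<open>push_up\<close> applies
  directly. Otherwise the pushed-down family avoids a set \<open>\<D>\<close> of
  \<open>d\<close>-dimensional spaces too large for equality.\<close>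

lemma even_union_antichain_bound:
  assumes sub: "\<F> \<subseteq> all_subspaces scale" and anti: "subspace_antichain \<F>"
    and un: "s_union scale (2 * d) \<F>" and d: "2 \<le> d" "2 * d < n"
    and non: "\<not> \<F> \<subseteq> subspaces_of_dim scale d"
  shows "real (card \<F>) \<le> gauss_binomial q n d - real q * gauss_binomial q (n - d) 1"
    and "real (card \<F>) = gauss_binomial q n d - real q * gauss_binomial q (n - d) 1 \<Longrightarrow>
      is_family_A scale (2 * d) \<F>"
proof -
  let ?b = "gauss_binomial q n d - real q * gauss_binomial q (n - d) 1"
  have "real (card \<F>) \<le> ?b \<and> (real (card \<F>) = ?b \<longrightarrow> is_family_A scale (2 * d) \<F>)"
  proof (cases "\<forall>F\<in>\<F>. dim F \<le> d")
    case True
    moreover have "\<exists>F\<in>\<F>. dim F < d"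
      using non sub True by (force simp: subspaces_of_dim_def all_subspaces_def)
    ultimately show ?thesis
      using push_up[of \<F> d 0 "d - 1"] sub anti d by auto
  next
    case False
    then obtain W where W: "W \<in> \<F>" "d < dim W" by force
    have "\<forall>F\<in>\<F>. dim F \<le> d + n" using dim_le_n by (simp add: trans_le_add2)
    then obtain \<G> where G: "\<G> \<subseteq> all_subspaces scale" "subspace_antichain \<G>" "\<forall>G\<in>\<G>. dim G \<le> d"
        "card \<F> \<le> card \<G>" and dom: "\<forall>G\<in>\<G>. \<exists>F\<in>\<F>. G \<subseteq> F"
      using push_down[OF sub anti un, of d n] by auto
    obtain \<D> where D: "\<D> \<subseteq> subspaces_of_dim scale d" "card \<D> = q ^ (d * (n - d))" "\<D> \<inter> \<G> = {}"
      using large_member_excludes[OF sub un W(1) _ d(2) _ dom, of d] W(2) by auto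
    have big: "1 + real q * gauss_binomial q (n - d) 1 < real (card \<D>)"
      unfolding D(2) using d by (intro superspace_count_less) auto
    have "real (card \<G>) < ?b"
    proof (cases "\<exists>G\<in>\<G>. dim G < d")
      case True
      have "real (card \<G>) \<le> ?b" and A: "real (card \<G>) = ?b \<longrightarrow> is_family_A scale (2 * d) \<G>"
        using push_up[of \<G> d 0 "d - 1"] G d True by auto
      \<comment> \<open>Among the \<open>d\<close>-dimensional spaces, such a family misses only the
        covers of \<open>U\<close>, and these are fewer than \<open>\<D>\<close>.\<close>
      moreover have "\<not> is_family_A scale (2 * d) \<G>"
      proof
        assume "is_family_A scale (2 * d) \<G>"
        then obtain U where U: "U \<in> subspaces_of_dim scale (d - 1)" "\<G> = family_A scale (2 * d) U"
          by (auto simp: is_family_A_def)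
        obtain l where l: "d = Suc l" using d by (cases d) auto
        have "\<D> \<subseteq> upper_shadow l {U}"
          using D(1,3) U(2) l by (auto simp: family_A_def upper_shadow_def)
        then have "card \<D> \<le> card (upper_shadow l {U})"
          by (rule card_mono[OF finite_vector_sets])
        then show False
          using card_upper_shadow_singleton[of U l] U(1) l d big by simp
      qed
      ultimately show ?thesis by force
    next
      case False
      then have "\<G> \<subseteq> subspaces_of_dim scale d - \<D>"
        using G D(3) by (force simp: all_subspaces_def subspaces_of_dim_def)
      then have "card \<G> \<le> card (subspaces_of_dim scale d - \<D>)"
        by (rule card_mono[OF finite_vector_sets])
      also have "\<dots> = card (subspaces_of_dim scale d) - card \<D>"
        using D(1) finite_vector_sets by (rule card_Diff_subset[rotated])
      finally have "card \<G> \<le> card (subspaces_of_dim scale d) - card \<D>" .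
      moreover have "card \<D> \<le> card (subspaces_of_dim scale d)"
        using D(1) by (rule card_mono[OF finite_vector_sets])
      ultimately have "real (card \<G>) + real (card \<D>) \<le> real (card (subspaces_of_dim scale d))"
        by linarith
      then show ?thesis
        using card_subspaces_of_dim[of d] d big by simp
    qed
    then show ?thesis using G(4) by linarith
  qed
  then show "real (card \<F>) \<le> ?b" "real (card \<F>) = ?b \<Longrightarrow> is_family_A scale (2 * d) \<F>"
    by auto
qed

text \<open>A member \<open>X\<close> of dimension other than one is comparable with every member:
  the zero space lies in all of them, and a space of dimension at least two already exhausts the
  union bound, so it contains them all.\<close>

lemma two_union_antichain:
  assumes sub: "\<F> \<subseteq> all_subspaces scale" and anti: "subspace_antichain \<F>"
    and un: "s_union scale 2 \<F>" and non: "\<not> \<F> \<subseteq> subspaces_of_dim scale 1"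
  shows "card \<F> = 1"
proof -
  obtain X where X: "X \<in> \<F>" "dim X \<noteq> 1"
    using non sub by (auto simp: subspaces_of_dim_def all_subspaces_def)
  have ss: "subspace F" if "F \<in> \<F>" for F using that sub by (auto simp: all_subspaces_def)
  have "F = X" if F: "F \<in> \<F>" for F
  proof (cases "dim X = 0")
    case True
    then have "X \<subseteq> F" using subspace_0[OF ss[OF F]] by auto
    then show ?thesis using anti F X by (auto simp: subspace_antichain_def)
  next
    case False
    have "dim (X \<union> F) \<le> 2"
      using un[unfolded s_union_iff[OF sub]] F X by blast
    then have "dim (X \<union> F) \<le> dim X" using False X(2) by linarith
    then have "X = span (X \<union> F)"
      using ss X by (intro subspace_dim_equal) (auto intro: span_base)
    then have "F \<subseteq> X" using span_superset[of "X \<union> F"] by auto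
    then show ?thesis using anti F X by (auto simp: subspace_antichain_def)
  qed
  then have "\<F> = {X}" using X by blast
  then show ?thesis by simp
qed

text \<open>Besides the plane \<open>W\<close> the family contains every line outside
  \<open>W\<close>, and \<open>3 \<le> n\<close> provides one.\<close>

lemma family_B_2_not_singleton:
  assumes "is_family_B scale 2 \<F>" "3 \<le> n"
  shows "card \<F> \<noteq> 1"
proof
  assume "card \<F> = 1"
  obtain W where W: "subspace W" "dim W = 2" and F: "\<F> = family_B scale 2 W"
    using assms by (auto simp: is_family_B_def subspaces_of_dim_def)
  have "W \<noteq> UNIV" using W assms by auto
  then obtain x where x: "x \<notin> W" by auto
  then have "x \<noteq> 0" using subspace_0[OF W(1)] by auto
  then have "span {x} \<in> \<F>"
    using x by (auto simp: F family_B_def subspaces_of_dim_def dim_insert intro: span_base)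
  moreover have "W \<in> \<F>" by (simp add: F family_B_def)
  moreover have "span {x} \<noteq> W" using x by (auto intro: span_base)
  ultimately show False using \<open>card \<F> = 1\<close> by (auto simp: card_1_singleton_iff)
qed

text \<open>Three unfoldings of the recursion give \<open>1 + q + q^2 * (1 + ...)\<close>, so after
  subtracting \<open>q\<close> more than \<open>1\<close> remains. A one-element family therefore
  misses the bound for \<open>d = 1\<close>.\<close>

lemma gauss_binomial_1_minus_q_gt_1:
  assumes "3 \<le> m"
  shows "1 < gauss_binomial q m 1 - real q"
proof -
  define k where "k = m - 3"
  have k: "m = Suc (Suc (Suc k))" using assms by (simp add: k_def)
  have "0 \<le> real q * gauss_binomial q k 1" using gauss_binomial_1_nonneg by simp
  then have "real q * (real q * 1) \<le> real q * (real q * (1 + real q * gauss_binomial q k 1))"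
    by (intro mult_left_mono) auto
  moreover have "0 < real q * real q" using q_ge_2 by simp
  ultimately show ?thesis
    unfolding k gauss_binomial_Suc_1 by (simp add: distrib_left)
qed

section \<open>The families attaining equality in (i)\<close>

lemma odd_union_antichain_extremal:
  assumes sub: "\<F> \<subseteq> all_subspaces scale" and anti: "subspace_antichain \<F>"
    and un: "s_union scale (2 * d + 1) \<F>" and d: "2 * d + 1 < n" "1 \<le> d"
    and eq: "real (card \<F>) = gauss_binomial q n d"
  shows "\<exists>\<F>\<^sub>d \<F>\<^sub>d\<^sub>1. \<F> = \<F>\<^sub>d \<union> \<F>\<^sub>d\<^sub>1 \<and> \<F>\<^sub>d\<^sub>1 \<subseteq> subspaces_of_dim scale (d + 1) \<and>
    \<F>\<^sub>d = subspaces_of_dim scale d - shadow scale (d + 1) \<F>\<^sub>d\<^sub>1 \<and>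
    card (shadow scale (d + 1) \<F>\<^sub>d\<^sub>1) = card \<F>\<^sub>d\<^sub>1"
proof -
  \<comment> \<open>For \<open>s = 2 * d + 1\<close> the bounds \<open>s div 2\<close> and
    \<open>s - s div 2\<close> are \<open>d\<close> and \<open>d + 1\<close>.\<close>
  have dims: "dim F = d \<or> dim F = Suc d" if "F \<in> \<F>" for F
    using s_union_antichain_bound(2)[OF sub anti un, of F] that eq d by auto
  have ss: "subspace F" if "F \<in> \<F>" for F using that sub by (auto simp: all_subspaces_def)
  define L where "L = {F \<in> \<F>. dim F = d}"
  define H where "H = {F \<in> \<F>. dim F = Suc d}"
  let ?S = "shadow scale (Suc d) H"
  have F: "\<F> = L \<union> H" using dims by (auto simp: L_def H_def)
  have H: "H \<subseteq> subspaces_of_dim scale (Suc d)"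
    using ss by (auto simp: H_def subspaces_of_dim_def)
  have "card H \<le> card ?S"
  proof (rule card_le_card_shadow[OF H])
    fix X Y assume "X \<in> H" "Y \<in> H"
    then have "dim (X \<union> Y) + dim (X \<inter> Y) = 2 * Suc d" "dim (X \<union> Y) \<le> 2 * d + 1"
      using dim_Un_Int[of X Y] ss un[unfolded s_union_iff[OF sub]] by (auto simp: H_def)
    then show "1 \<le> dim (X \<inter> Y)" by arith
  qed
  moreover have sh: "?S \<subseteq> subspaces_of_dim scale d"
    by (auto simp: shadow_def subspaces_of_dim_def)
  moreover have L: "L \<subseteq> subspaces_of_dim scale d - ?S"
  proof
    fix X assume X: "X \<in> L"
    then have "X \<notin> ?S"
      using anti by (force simp: L_def H_def shadow_def subspace_antichain_def)
    then show "X \<in> subspaces_of_dim scale d - ?S"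
      using X ss by (auto simp: L_def subspaces_of_dim_def)
  qed
  moreover have "card (subspaces_of_dim scale d) = card \<F>"
    using eq card_subspaces_of_dim[of d] d by simp
  moreover have "card \<F> = card L + card H"
    unfolding F by (intro card_Un_disjoint finite_vector_sets) (auto simp: L_def H_def)
  moreover have "card (subspaces_of_dim scale d) = card (subspaces_of_dim scale d - ?S) + card ?S"
    using sh card_mono[OF finite_vector_sets sh] by (simp add: card_Diff_subset finite_vector_sets)
  moreover have "card L \<le> card (subspaces_of_dim scale d - ?S)"
    using L by (rule card_mono[OF finite_vector_sets])
  \<comment> \<open>\<open>L\<close> avoids the shadow and \<open>H\<close> is no larger than the
    shadow; since the sizes add up to the number of all \<open>d\<close>-dimensional spaces, both
    estimates are tight.\<close>
  ultimately have "card L = card (subspaces_of_dim scale d - ?S)" "card ?S = card H"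
    by linarith+
  moreover from this have "L = subspaces_of_dim scale d - ?S"
    using L by (intro card_subset_eq finite_vector_sets)
  ultimately show ?thesis
    using F H by (intro exI[of _ L] exI[of _ H]) auto
qed

lemma card_odd_extremal:
  assumes "\<H> \<subseteq> subspaces_of_dim scale (d + 1)" "d \<le> n"
    and "card (shadow scale (d + 1) \<H>) = card \<H>"
  shows "real (card (subspaces_of_dim scale d - shadow scale (d + 1) \<H> \<union> \<H>)) = gauss_binomial q n d"
proof -
  let ?S = "shadow scale (d + 1) \<H>"
  have sh: "?S \<subseteq> subspaces_of_dim scale d"
    by (auto simp: shadow_def subspaces_of_dim_def)
  have "card (subspaces_of_dim scale d - ?S \<union> \<H>) = card (subspaces_of_dim scale d - ?S) + card \<H>"
    using assms(1) by (intro card_Un_disjoint finite_vector_sets) (auto simp: subspaces_of_dim_def)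
  also have "\<dots> = card (subspaces_of_dim scale d)"
    using sh assms(3) card_mono[OF finite_vector_sets sh] by (simp add: card_Diff_subset finite_vector_sets)
  finally show ?thesis using card_subspaces_of_dim[OF assms(2)] by simp
qed

lemma s_union_antichain_card_eq_iff:
  assumes sub: "\<F> \<subseteq> all_subspaces scale" and anti: "subspace_antichain \<F>"
    and un: "s_union scale s \<F>" and s: "2 \<le> s" "s < n"
  shows "real (card \<F>) = gauss_binomial q n (s div 2) \<longleftrightarrow>
    \<F> = subspaces_of_dim scale (s div 2) \<or>
    (\<exists>d \<F>\<^sub>d \<F>\<^sub>d\<^sub>1. s = 2 * d + 1 \<and> \<F> = \<F>\<^sub>d \<union> \<F>\<^sub>d\<^sub>1 \<and>
      \<F>\<^sub>d\<^sub>1 \<subseteq> subspaces_of_dim scale (d + 1) \<and>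
      \<F>\<^sub>d = subspaces_of_dim scale d - shadow scale (d + 1) \<F>\<^sub>d\<^sub>1 \<and>
      card (shadow scale (d + 1) \<F>\<^sub>d\<^sub>1) = card \<F>\<^sub>d\<^sub>1)" (is "?eq \<longleftrightarrow> ?a \<or> ?b")
proof
  assume eq: ?eq
  show "?a \<or> ?b"
  proof (cases "even s")
    case True
    then obtain d where s2: "s = 2 * d" by (auto elim: evenE)
    \<comment> \<open>For even \<open>s\<close> the lower and upper bounds on the dimension
      coincide.\<close>
    have "dim F = d" if "F \<in> \<F>" for F
      using s_union_antichain_bound(2)[OF assms eq that] s2 by auto
    then have "\<F> \<subseteq> subspaces_of_dim scale d"
      using sub by (auto simp: subspaces_of_dim_def all_subspaces_def)
    moreover have "card \<F> = card (subspaces_of_dim scale d)"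
      using eq card_subspaces_of_dim[of d] s s2 by simp
    ultimately have "\<F> = subspaces_of_dim scale d"
      by (intro card_subset_eq finite_vector_sets)
    then show ?thesis using s2 by simp
  next
    case False
    then obtain d where s2: "s = 2 * d + 1" by (auto elim: oddE)
    then have "s div 2 = d" "2 * d + 1 < n" "1 \<le> d" using s by auto
    then have ?b
      using odd_union_antichain_extremal[OF sub anti un[unfolded s2]] eq s2 by metis
    then show ?thesis ..
  qed
next
  assume "?a \<or> ?b"
  then show ?eq
  proof
    assume ?a
    then show ?thesis using card_subspaces_of_dim[of "s div 2"] s by simp
  next
    assume ?b
    then obtain d \<L> \<H> where s2: "s = 2 * d + 1" and F: "\<F> = \<L> \<union> \<H>"
      and H: "\<H> \<subseteq> subspaces_of_dim scale (d + 1)"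
      and L: "\<L> = subspaces_of_dim scale d - shadow scale (d + 1) \<H>"
      and c: "card (shadow scale (d + 1) \<H>) = card \<H>"
      by (elim exE conjE) (rule that)
    show ?thesis
      unfolding F L using card_odd_extremal[OF H _ c] s s2 by simp
  qed
qed

end

section \<open>The theorem for an arbitrary vector space over a finite field\<close>

theorem theorem6:
  fixes scale :: "'a :: {field, finite} \<Rightarrow> 'b :: ab_group_add \<Rightarrow> 'b"
    and q n s :: nat
    and \<F> :: "'b set set"
  assumes "vector_space scale"
    and "q = CARD('a)"
    and "vector_space.dim scale (UNIV :: 'b set) = n"
    and "2 \<le> s" and "s < n"
    and "\<F> \<subseteq> all_subspaces scale"
    and "s_union scale s \<F>"
    and "subspace_antichain \<F>"
  shows
    "(real (card \<F>) \<le> gauss_binomial q n (s div 2) \<and>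
      (real (card \<F>) = gauss_binomial q n (s div 2) \<longleftrightarrow>
        \<F> = subspaces_of_dim scale (s div 2) \<or>
        (\<exists>d \<F>\<^sub>d \<F>\<^sub>d\<^sub>1. s = 2 * d + 1 \<and> \<F> = \<F>\<^sub>d \<union> \<F>\<^sub>d\<^sub>1 \<and>
          \<F>\<^sub>d\<^sub>1 \<subseteq> subspaces_of_dim scale (d + 1) \<and>
          \<F>\<^sub>d = subspaces_of_dim scale d - shadow scale (d + 1) \<F>\<^sub>d\<^sub>1 \<and>
          card (shadow scale (d + 1) \<F>\<^sub>d\<^sub>1) = card \<F>\<^sub>d\<^sub>1))) \<and>
     (\<forall>d. s = 2 * d \<and> \<not> \<F> \<subseteq> subspaces_of_dim scale d \<longrightarrow>
        (d = 1 \<longrightarrow>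
          real (card \<F>) \<le> gauss_binomial q n 1 - real q \<and>
          (real (card \<F>) = gauss_binomial q n 1 - real q \<longleftrightarrow>
            is_family_B scale 2 \<F>)) \<and>
        (d \<ge> 2 \<longrightarrow>
          real (card \<F>) \<le> gauss_binomial q n d - real q * gauss_binomial q (n - d) 1 \<and>
          (real (card \<F>) = gauss_binomial q n d - real q * gauss_binomial q (n - d) 1 \<longleftrightarrow>
            is_family_A scale (2 * d) \<F>)))"
proof -
  interpret vs: vector_space scale by fact
  obtain Basis where B: "vs.independent Basis" "UNIV \<subseteq> vs.span Basis" "card Basis = n"
    using vs.basis_exists[of UNIV] assms(3) by metis
  \<comment> \<open>An infinite set has \<open>card\<close> equal to \<open>0\<close>, which
    \<open>s < n\<close> rules out, so the assumed dimension is a genuine finite one.\<close>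
  have "finite Basis" using B(3) assms(5) by (metis card.infinite not_less_zero)
  then interpret V: finite_field_space scale Basis q
    using B assms(2) by unfold_locales auto
  note F = assms(6,8,7)
  have s: "2 \<le> s" "s < card Basis" using assms(4,5) B(3) by auto
  have even: "(d = 1 \<longrightarrow>
          real (card \<F>) \<le> gauss_binomial q n 1 - real q \<and>
          (real (card \<F>) = gauss_binomial q n 1 - real q \<longleftrightarrow> is_family_B scale 2 \<F>)) \<and>
        (d \<ge> 2 \<longrightarrow>
          real (card \<F>) \<le> gauss_binomial q n d - real q * gauss_binomial q (n - d) 1 \<and>
          (real (card \<F>) = gauss_binomial q n d - real q * gauss_binomial q (n - d) 1 \<longleftrightarrow>
            is_family_A scale (2 * d) \<F>))"
    if sd: "s = 2 * d" and non: "\<not> \<F> \<subseteq> subspaces_of_dim scale d" for d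
  proof (intro conjI impI)
    assume d: "d = 1"
    have n3: "3 \<le> n" using assms(5) sd d by simp
    \<comment> \<open>For \<open>d = 1\<close> both sides of the equivalence fail: a single member
      is fewer than the bound, and \<open>\<B>[n,2]\<close> has more than one member.\<close>
    have one: "card \<F> = 1"
      using V.two_union_antichain[OF F(1,2)] F(3) sd non d by simp
    moreover have "1 < gauss_binomial q n 1 - real q"
      using V.gauss_binomial_1_minus_q_gt_1[OF n3] .
    moreover have "\<not> is_family_B scale 2 \<F>"
      using V.family_B_2_not_singleton[of \<F>] one n3 B(3) by auto
    ultimately show "real (card \<F>) \<le> gauss_binomial q n 1 - real q"
      "real (card \<F>) = gauss_binomial q n 1 - real q \<longleftrightarrow> is_family_B scale 2 \<F>"
      by auto
  next
    assume d: "2 \<le> d"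
    note b = V.even_union_antichain_bound[OF F[unfolded sd] d s(2)[unfolded sd] non, unfolded B(3)]
    show "real (card \<F>) \<le> gauss_binomial q n d - real q * gauss_binomial q (n - d) 1"
      by (rule b(1))
    show "real (card \<F>) = gauss_binomial q n d - real q * gauss_binomial q (n - d) 1 \<longleftrightarrow>
        is_family_A scale (2 * d) \<F>"
      using b(2) V.card_family_A[of d \<F>, unfolded B(3)] d sd assms(5) by auto
  qed
  show ?thesis
    by (rule conjI[OF conjI[OF V.s_union_antichain_bound(1)[OF F s, unfolded B(3)]
          V.s_union_antichain_card_eq_iff[OF F s, unfolded B(3)]]]; intro allI impI; elim conjE; rule even)
qed

end
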